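(* Let $\Sigma_1,\ldots,\Sigma_r$ be signed graphs, where $\Sigma_i$ has $n_i$ vertices, eigenvalues $\lambda_{ij}$ ($1\le j\le n_i$), and a $k_i$-regular underlying graph. Let $k=k_1+\cdots+k_r$, $n=n_1\cdots n_r$, and let $\Sigma=\Sigma_1\times\cdots\times\Sigma_r$ be the Cartesian product. Then the underlying graph of $\Sigma$ is $k$-regular and that of the line graph $\Lambda(\Sigma)$ is $2(k-1)$-regular. The line graph $\Lambda(\Sigma)$ has eigenvalues $$\lambda_{j_1j_2\ldots j_r}=2-k+(\lambda_{1j_1}+\cdots+\lambda_{rj_r}),\qquad 1\le j_1\le n_1,\ldots,1\le j_r\le n_r,$$ of which exactly $b(\Sigma)=b(\Sigma_1)\cdots b(\Sigma_r)$ are equal to $2$ and the remainder are $<2$ and $\ge-2(k-1)$ (amongst which are exactly $b(-\Sigma)=b(-\Sigma_1)\cdots b(-\Sigma_r)$ equal to $-2(k-1)$), together with $n(k-2)$ additional eigenvalues equal to $2$. It has energy, also equal to the Laplacian energy, given by $$E(\Lambda(\Sigma))=E_L(\Lambda(\Sigma))=\sum_{j_1=1}^{n_1}\cdots\sum_{j_r=1}^{n_r}\big|(\lambda_{1j_1}+\cdots+\lambda_{rj_r})+2-k\big|+2(k-2)n.$$ It has Laplacian eigenvalues $$\lambda_{j_1j_2\ldots j_r}^L=3k-4-(\lambda_{1j_1}+\cdots+\lambda_{rj_r}),$$ of which exactly $b(\Sigma_1)\cdots b(\Sigma_r)$ are equal to $2k-4$ and the remainder are $>2k-4$ and $\le4k-6$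 (of which exactly $b(-\Sigma)=b(-\Sigma_1)\cdots b(-\Sigma_r)$ are equal to $4k-6$), together with $n(k-2)$ additional eigenvalues equal to $2k-4$.
   Context: All graphs are finite, simple and loop-free. A signed graph $\Sigma=(G,\sigma)$ is a graph $G=(V,E)$ with a function $\sigma:E\to\{+1,-1\}$; $-\Sigma=(G,-\sigma)$. The sign of a cycle is the product of its edge signs; a signed graph is balanced if every cycle is positive. $b(\Sigma)$ is the number of connected components of $\Sigma$ that are balanced. The adjacency matrix $A(\Sigma)$ has $(u,v)$ entry $\sigma(uv)$ if $u,v$ are adjacent and $0$ otherwise; its eigenvalues are the eigenvalues of $\Sigma$, and the energy $E(\Sigma)$ is the sum of their absolute values. The Laplacian matrix is $L(\Sigma)=D(\Sigma)-A(\Sigma)$, $D(\Sigma)$ being the diagonal matrix of vertex degrees in $G$; its eigenvalues are the Laplacian eigenvalues. The Laplacian energy is $E_L(\Sigma)=\sum_j|\lambda_j(L(\Sigma))-\bar d(\Sigma)|$, where $\lambda_j(L(\Sigma))$ are the eigenvalues of $L(\Sigma)$ and $\bar d(\Sigma)=2|E|/|V|$. The Cartesian product of signed graphs $\Sigma_i=(V_i,E_i,\sigma_i)$ is the signed graph on $V_1\times\cdots\times V_r$ in which $(u_1,\ldots,u_r)$ and $(v_1,\ldots,v_r)$ are adjacent iff there is an index $i$ with $u_iv_i\in E_i$ and $u_j=v_j$ for all $j\ne i$, such an edge having sign $\sigma_i(u_iv_i)$. Incidence matrix of a signed graph with $p$ vertices and $q$ edges: a $p\times q$ matrix $H(\Sigma)=[\eta_{ik}]$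 with $\eta_{ik}=0$ if vertex $v_i$ is not incident with edge $e_k$, $\eta_{ik}=\pm1$ if it is, and $\eta_{ik}\eta_{jk}=-\sigma(v_iv_j)$ for each edge $e_k=v_iv_j$; unique up to multiplying columns by $-1$. Line graph: $\Lambda(\Sigma)$ is the signed graph whose underlying graph is the ordinary line graph of $G$, with signature given by $A(\Lambda(\Sigma))=2I_q-H(\Sigma)^{\mathrm T}H(\Sigma)$ (so every cycle of $\Sigma$ becomes a cycle of the same sign, and any three edges at a common vertex become a negative triangle); the choice of $H(\Sigma)$ does not affect eigenvalues or Laplacian eigenvalues. Convention: in exceptional cases where the number of "additional" eigenvalues equal to a value $\alpha$ is negative, it constitutes a deduction from the previously stated multiplicity $b(\Sigma)$ of $\alpha$.
   Formalization: Constants corrected: the additional eigenvalues number n(k-2)/2, not n(k-2) (K_4's line graph has only 6 eigenvalues); the last energy term is (k-2)n, not 2(k-2)n; the maximal Laplacian value is 4k-4, not 4k-6 (the positive 4-cycle gives 4). *)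

theory Defs
  imports "Jordan_Normal_Form.Char_Poly" "Jordan_Normal_Form.Conjugate" "HOL-Library.FuncSet"
begin

section \<open>Signed graphs\<close>

record 'v sgraph =
  sg_verts :: "'v set"
  sg_edges :: "'v set set"
  sg_sign  :: "'v set \<Rightarrow> real"

text \<open>The signature is only meaningful on the edges.  The empty graph is allowed: it arises as
  the line graph of an edgeless graph.\<close>

definition signed_graph :: "'v sgraph \<Rightarrow> bool" where
  "signed_graph S \<longleftrightarrow> finite (sg_verts S)
     \<and> (\<forall>e\<in>sg_edges S. e \<subseteq> sg_verts S \<and> card e = 2 \<and> sg_sign S e \<in> {1, -1})"

definition neg_sgraph :: "'v sgraph \<Rightarrow> 'v sgraph" where
  "neg_sgraph S = \<lparr>sg_verts = sg_verts S, sg_edges = sg_edges S, sg_sign = (\<lambda>e. - sg_sign S e)\<rparr>"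

definition degree_in :: "'v sgraph \<Rightarrow> 'v \<Rightarrow> nat" where
  "degree_in S v = card {e \<in> sg_edges S. v \<in> e}"

definition regular_sgraph :: "'v sgraph \<Rightarrow> nat \<Rightarrow> bool" where
  "regular_sgraph S k \<longleftrightarrow> (\<forall>v\<in>sg_verts S. degree_in S v = k)"


section \<open>Balance\<close>

text \<open>A cycle is the list of its vertices; the indices are read cyclically.\<close>

definition cycle_edge :: "'v list \<Rightarrow> nat \<Rightarrow> 'v set" where
  "cycle_edge vs i = {vs ! i, vs ! (Suc i mod length vs)}"

definition is_cycle :: "'v sgraph \<Rightarrow> 'v list \<Rightarrow> bool" where
  "is_cycle S vs \<longleftrightarrow> length vs \<ge> 3 \<and> distinct vs \<and> (\<forall>i<length vs. cycle_edge vs i \<in> sg_edges S)"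

definition cycle_sign :: "'v sgraph \<Rightarrow> 'v list \<Rightarrow> real" where
  "cycle_sign S vs = (\<Prod>i<length vs. sg_sign S (cycle_edge vs i))"

definition balanced :: "'v sgraph \<Rightarrow> bool" where
  "balanced S \<longleftrightarrow> (\<forall>vs. is_cycle S vs \<longrightarrow> cycle_sign S vs = 1)"

definition induced_sgraph :: "'v sgraph \<Rightarrow> 'v set \<Rightarrow> 'v sgraph" where
  "induced_sgraph S C = \<lparr>sg_verts = C, sg_edges = {e \<in> sg_edges S. e \<subseteq> C}, sg_sign = sg_sign S\<rparr>"

definition connected_in :: "'v sgraph \<Rightarrow> ('v \<times> 'v) set" where
  "connected_in S = {(u, v). u \<in> sg_verts S \<and> v \<in> sg_verts S
     \<and> (u, v) \<in> {(x, y). {x, y} \<in> sg_edges S}\<^sup>*}"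

definition sg_components :: "'v sgraph \<Rightarrow> 'v set set" where
  "sg_components S = sg_verts S // connected_in S"

definition num_balanced :: "'v sgraph \<Rightarrow> nat" where
  "num_balanced S = card {C \<in> sg_components S. balanced (induced_sgraph S C)}"


section \<open>Matrices, spectra and energies\<close>

definition vertex_list :: "'v sgraph \<Rightarrow> 'v list" where
  "vertex_list S = (SOME vs. distinct vs \<and> set vs = sg_verts S)"

text \<open>The choice of the enumeration of the vertices only affects the matrix by a simultaneous
  permutation of rows and columns, hence not its characteristic polynomial.\<close>

definition vertex_matrix :: "'v sgraph \<Rightarrow> ('v \<Rightarrow> 'v \<Rightarrow> real) \<Rightarrow> real mat" where
  "vertex_matrix S f = mat (card (sg_verts S)) (card (sg_verts S))
     (\<lambda>(i, j). f (vertex_list S ! i) (vertex_list S ! j))"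

definition adj_entry :: "'v sgraph \<Rightarrow> 'v \<Rightarrow> 'v \<Rightarrow> real" where
  "adj_entry S u v = (if {u, v} \<in> sg_edges S then sg_sign S {u, v} else 0)"

definition adjacency_matrix :: "'v sgraph \<Rightarrow> real mat" where
  "adjacency_matrix S = vertex_matrix S (adj_entry S)"

definition degree_matrix :: "'v sgraph \<Rightarrow> real mat" where
  "degree_matrix S = vertex_matrix S (\<lambda>u v. if u = v then real (degree_in S u) else 0)"

definition laplacian_matrix :: "'v sgraph \<Rightarrow> real mat" where
  "laplacian_matrix S = degree_matrix S - adjacency_matrix S"

text \<open>The eigenvalues with multiplicities, as the roots of the characteristic polynomial.
  The matrices used here are symmetric, so no eigenvalue is lost by working over the reals
  (see \<open>size_mat_eigenvalues\<close> below).\<close>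

definition mat_eigenvalues :: "real mat \<Rightarrow> real multiset" where
  "mat_eigenvalues A = proots (char_poly A)"

definition sg_eigenvalues :: "'v sgraph \<Rightarrow> real multiset" where
  "sg_eigenvalues S = mat_eigenvalues (adjacency_matrix S)"

definition sg_laplacian_eigenvalues :: "'v sgraph \<Rightarrow> real multiset" where
  "sg_laplacian_eigenvalues S = mat_eigenvalues (laplacian_matrix S)"

definition energy :: "'v sgraph \<Rightarrow> real" where
  "energy S = (\<Sum>x\<in>#sg_eigenvalues S. \<bar>x\<bar>)"

definition average_degree :: "'v sgraph \<Rightarrow> real" where
  "average_degree S = 2 * real (card (sg_edges S)) / real (card (sg_verts S))"

definition laplacian_energy :: "'v sgraph \<Rightarrow> real" where
  "laplacian_energy S = (\<Sum>x\<in>#sg_laplacian_eigenvalues S. \<bar>x - average_degree S\<bar>)"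


section \<open>Cartesian products\<close>

text \<open>The vertices of the product are the extensional functions on \<open>{1..r}\<close>; a common vertex type
  of the factors is no restriction.  For an edge \<open>X = {f, g}\<close> of the product, \<open>(\<lambda>f. f i) ` X\<close> is
  an edge of the \<open>i\<close>-th factor for the unique coordinate \<open>i\<close> in which \<open>f\<close> and \<open>g\<close> differ, and a
  singleton for all other coordinates.\<close>

definition cartesian_product :: "nat \<Rightarrow> (nat \<Rightarrow> 'v sgraph) \<Rightarrow> (nat \<Rightarrow> 'v) sgraph" where
  "cartesian_product r G =
     \<lparr>sg_verts = (\<Pi>\<^sub>E i\<in>{1..r}. sg_verts (G i)),
      sg_edges = {{f, g} | f g. f \<in> (\<Pi>\<^sub>E i\<in>{1..r}. sg_verts (G i)) \<and> g \<in> (\<Pi>\<^sub>E i\<in>{1..r}. sg_verts (G i))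
        \<and> (\<exists>i\<in>{1..r}. {f i, g i} \<in> sg_edges (G i) \<and> (\<forall>j\<in>{1..r} - {i}. f j = g j))},
      sg_sign = (\<lambda>X. let i = (THE i. i \<in> {1..r} \<and> (\<lambda>f. f i) ` X \<in> sg_edges (G i))
                     in sg_sign (G i) ((\<lambda>f. f i) ` X))\<rparr>"


section \<open>Line graphs\<close>

text \<open>\<open>H v e\<close> is the entry of the incidence matrix in row \<open>v\<close> and column \<open>e\<close>.\<close>

definition incidence_matrix :: "'v sgraph \<Rightarrow> ('v \<Rightarrow> 'v set \<Rightarrow> real) \<Rightarrow> bool" where
  "incidence_matrix S H \<longleftrightarrow>
     (\<forall>v\<in>sg_verts S. \<forall>e\<in>sg_edges S. if v \<in> e then H v e \<in> {1, -1} else H v e = 0)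
     \<and> (\<forall>u\<in>sg_verts S. \<forall>v\<in>sg_verts S. {u, v} \<in> sg_edges S \<longrightarrow>
          H u {u, v} * H v {u, v} = - sg_sign S {u, v})"

text \<open>For \<open>X = {e, f}\<close> with \<open>e \<noteq> f\<close>, the sign below is minus the scalar product of the columns
  \<open>e\<close> and \<open>f\<close> of \<open>H\<close>; thus the adjacency matrix of the line graph is \<open>2I - H\<^sup>T H\<close>
  (see \<open>adj_entry_line_graph\<close> below).\<close>

definition line_graph :: "'v sgraph \<Rightarrow> ('v \<Rightarrow> 'v set \<Rightarrow> real) \<Rightarrow> 'v set sgraph" where
  "line_graph S H =
     \<lparr>sg_verts = sg_edges S,
      sg_edges = {{e, f} | e f. e \<in> sg_edges S \<and> f \<in> sg_edges S \<and> e \<noteq> f \<and> e \<inter> f \<noteq> {}},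
      sg_sign = (\<lambda>X. - (\<Sum>v\<in>sg_verts S. \<Prod>e\<in>X. H v e))\<rparr>"


section \<open>Well-definedness\<close>

lemma signed_graphD:
  assumes "signed_graph S"
  shows "finite (sg_verts S)" "finite (sg_edges S)"
    and "e \<in> sg_edges S \<Longrightarrow> e \<subseteq> sg_verts S"
    and "e \<in> sg_edges S \<Longrightarrow> card e = 2"
    and "e \<in> sg_edges S \<Longrightarrow> sg_sign S e \<in> {1, -1}"
proof -
  have "sg_edges S \<subseteq> Pow (sg_verts S)" using assms by (auto simp: signed_graph_def)
  then show "finite (sg_edges S)"
    using assms finite_subset by (auto simp: signed_graph_def)
qed (use assms in \<open>auto simp: signed_graph_def\<close>)

lemma incidence_matrix_exists:
  assumes "signed_graph S"
  shows "\<exists>H. incidence_matrix S H"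
proof -
  define a where "a = (\<lambda>e. SOME x::'a. x \<in> e)"
  have a: "a e \<in> e" if "e \<in> sg_edges S" for e
  proof -
    have "e \<noteq> {}" using signed_graphD(4)[OF assms that] by auto
    then show ?thesis unfolding a_def by (simp add: some_in_eq)
  qed
  define H where "H = (\<lambda>v e. if v \<notin> e then 0 else if v = a e then 1 else - sg_sign S e)"
  have "incidence_matrix S H"
    unfolding incidence_matrix_def
  proof (intro conjI ballI impI)
    fix v e assume "e \<in> sg_edges S"
    then show "if v \<in> e then H v e \<in> {1, -1} else H v e = 0"
      using signed_graphD(5)[OF assms, of e] by (auto simp: H_def)
  next
    fix u v assume e: "{u, v} \<in> sg_edges S"
    then have "u \<noteq> v" using signed_graphD(4)[OF assms e] by auto
    moreover have "a {u, v} \<in> {u, v}" using a[OF e] .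
    ultimately show "H u {u, v} * H v {u, v} = - sg_sign S {u, v}" by (auto simp: H_def)
  qed
  then show ?thesis by blast
qed

lemma adj_entry_line_graph:
  assumes S: "signed_graph S" and H: "incidence_matrix S H"
    and e: "e \<in> sg_edges S" and f: "f \<in> sg_edges S"
  shows "adj_entry (line_graph S H) e f
    = (if e = f then 2 else 0) - (\<Sum>v\<in>sg_verts S. H v e * H v f)"
proof -
  note fin = signed_graphD(1)[OF S]
  have H0: "H v e = 0" if "v \<in> sg_verts S" "v \<notin> e" "e \<in> sg_edges S" for v e
    using H that unfolding incidence_matrix_def by (metis (full_types))
  have H1: "H v e * H v e = 1" if "v \<in> sg_verts S" "v \<in> e" "e \<in> sg_edges S" for v e
  proof -
    have "H v e \<in> {1, -1}" using H that unfolding incidence_matrix_def by (metis (full_types))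
    then show ?thesis by auto
  qed
  have edge: "{e, f} \<in> sg_edges (line_graph S H) \<longleftrightarrow> e \<noteq> f \<and> e \<inter> f \<noteq> {}"
    using e f by (auto simp: line_graph_def doubleton_eq_iff)
  show ?thesis
  proof (cases "e = f")
    case True
    have "(\<Sum>v\<in>sg_verts S. H v e * H v e) = (\<Sum>v\<in>e. H v e * H v e)"
      using H0[OF _ _ e] by (intro sum.mono_neutral_right fin signed_graphD(3)[OF S e]) auto
    also have "\<dots> = (\<Sum>v\<in>e. 1)"
      using H1[OF _ _ e] signed_graphD(3)[OF S e] by (intro sum.cong) auto
    also have "\<dots> = 2" using signed_graphD(4)[OF S e] by simp
    finally show ?thesis using True edge by (simp add: adj_entry_def)
  next
    case False
    have "e \<inter> f = {} \<Longrightarrow> (\<Sum>v\<in>sg_verts S. H v e * H v f) = 0"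
      using H0[OF _ _ e] H0[OF _ _ f] by (intro sum.neutral) auto
    then show ?thesis using False edge by (auto simp: adj_entry_def line_graph_def)
  qed
qed

lemma signed_graph_line_graph:
  assumes S: "signed_graph S" and H: "incidence_matrix S H"
  shows "signed_graph (line_graph S H)"
  unfolding signed_graph_def
proof (intro conjI ballI)
  show "finite (sg_verts (line_graph S H))" using signed_graphD[OF S] by (simp add: line_graph_def)
next
  fix X assume "X \<in> sg_edges (line_graph S H)"
  then obtain e f where X: "X = {e, f}" and e: "e \<in> sg_edges S" and f: "f \<in> sg_edges S"
    and ne: "e \<noteq> f" and int: "e \<inter> f \<noteq> {}"
    by (auto simp: line_graph_def)
  show "X \<subseteq> sg_verts (line_graph S H)" using X e f by (simp add: line_graph_def)
  show "card X = 2" using X ne by simp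
  from int obtain w where w: "w \<in> e" "w \<in> f" by auto
  have ef: "e \<inter> f = {w}"
  proof (rule ccontr)
    assume "e \<inter> f \<noteq> {w}"
    then obtain x where x: "x \<in> e" "x \<in> f" "x \<noteq> w" using w by auto
    have "{x, w} = d" if "d \<in> sg_edges S" "x \<in> d" "w \<in> d" for d
    proof (rule card_seteq)
      show "finite d" using signed_graphD(4)[OF S that(1)] by (simp add: card_ge_0_finite)
      show "card d \<le> card {x, w}" using signed_graphD(4)[OF S that(1)] x(3) by simp
    qed (use that in simp)
    then have "e = f" using e f x w by metis
    then show False using ne by simp
  qed
  have wV: "w \<in> sg_verts S" using signed_graphD(3)[OF S e] w by auto
  have H': "if v \<in> e then H v e \<in> {1, -1} else H v e = 0"
    if "v \<in> sg_verts S" "e \<in> sg_edges S" for v e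
    using H that unfolding incidence_matrix_def by blast
  have "(\<Sum>v\<in>sg_verts S. H v e * H v f) = (\<Sum>v\<in>{w}. H v e * H v f)"
  proof (rule sum.mono_neutral_right)
    show "\<forall>v\<in>sg_verts S - {w}. H v e * H v f = 0"
    proof
      fix v assume v: "v \<in> sg_verts S - {w}"
      then have "v \<notin> e \<or> v \<notin> f" using ef by auto
      then show "H v e * H v f = 0" using H'[of v e] H'[of v f] v e f by auto
    qed
  qed (use wV signed_graphD(1)[OF S] in auto)
  then have "sg_sign (line_graph S H) X = - (H w e * H w f)"
    using X ne by (simp add: line_graph_def)
  moreover have "H w e \<in> {1, -1}" "H w f \<in> {1, -1}"
    using H'[OF wV e] H'[OF wV f] w by simp_all
  ultimately show "sg_sign (line_graph S H) X \<in> {1, -1}" by auto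
qed

lemma cartesian_product_sign:
  assumes "\<And>i. i \<in> {1..r} \<Longrightarrow> signed_graph (G i)"
    and "i \<in> {1..r}" "{f i, g i} \<in> sg_edges (G i)" "\<forall>j\<in>{1..r} - {i}. f j = g j"
  shows "sg_sign (cartesian_product r G) {f, g} = sg_sign (G i) {f i, g i}"
proof -
  have "(THE i. i \<in> {1..r} \<and> (\<lambda>h. h i) ` {f, g} \<in> sg_edges (G i)) = i"
  proof (rule the_equality)
    show "i \<in> {1..r} \<and> (\<lambda>h. h i) ` {f, g} \<in> sg_edges (G i)" using assms by simp
  next
    fix j assume j: "j \<in> {1..r} \<and> (\<lambda>h. h j) ` {f, g} \<in> sg_edges (G j)"
    show "j = i"
    proof (rule ccontr)
      assume "j \<noteq> i"
      then have "f j = g j" using assms j by auto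
      then have "{g j} \<in> sg_edges (G j)" using j by simp
      then show False using signed_graphD(4)[of "G j" "{g j}"] assms(1) j by auto
    qed
  qed
  then show ?thesis
    by (simp only: cartesian_product_def sgraph.simps Let_def image_insert image_empty)
qed

lemma signed_graph_cartesian_product:
  assumes "\<And>i. i \<in> {1..r} \<Longrightarrow> signed_graph (G i)"
  shows "signed_graph (cartesian_product r G)"
  unfolding signed_graph_def
proof (intro conjI ballI)
  show "finite (sg_verts (cartesian_product r G))"
    using signed_graphD(1)[OF assms] by (auto simp: cartesian_product_def intro!: finite_PiE)
next
  fix X assume "X \<in> sg_edges (cartesian_product r G)"
  then obtain f g where X: "X = {f, g}"
    and fg: "f \<in> sg_verts (cartesian_product r G)" "g \<in> sg_verts (cartesian_product r G)"
    and ex: "\<exists>i\<in>{1..r}. {f i, g i} \<in> sg_edges (G i) \<and> (\<forall>j\<in>{1..r} - {i}. f j = g j)"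
    unfolding cartesian_product_def by (simp del: PiE_iff One_nat_def atLeastAtMost_iff) blast
  from ex obtain i where i: "i \<in> {1..r}" "{f i, g i} \<in> sg_edges (G i)"
      "\<forall>j\<in>{1..r} - {i}. f j = g j"
    by blast
  show "X \<subseteq> sg_verts (cartesian_product r G)" using X fg by simp
  have "card {f i, g i} = 2" using signed_graphD(4)[OF assms[OF i(1)] i(2)] .
  then have "f \<noteq> g" by auto
  then show "card X = 2" using X by simp
  have "sg_sign (cartesian_product r G) X = sg_sign (G i) {f i, g i}"
    unfolding X using cartesian_product_sign[where r=r and G=G and i=i and f=f and g=g] assms i
    by blast
  then show "sg_sign (cartesian_product r G) X \<in> {1, -1}"
    using signed_graphD(5)[OF assms[OF i(1)] i(2)] by simp
qed

text \<open>The characteristic polynomial of a real symmetric matrix splits over the reals.\<close>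

lemma symmetric_eigenvalue_real:
  fixes A :: "real mat" and k :: complex
  assumes A: "A \<in> carrier_mat m m"
    and sym: "\<And>i j. i < m \<Longrightarrow> j < m \<Longrightarrow> A $$ (i, j) = A $$ (j, i)"
    and ev: "eigenvalue (map_mat complex_of_real A) k"
  shows "k \<in> \<real>"
proof -
  let ?B = "map_mat complex_of_real A"
  from ev obtain v where v: "v \<in> carrier_vec m" "v \<noteq> 0\<^sub>v m" "?B *\<^sub>v v = k \<cdot>\<^sub>v v"
    using A by (auto simp: eigenvalue_def eigenvector_def)
  have Bv: "(\<Sum>j<m. of_real (A $$ (i, j)) * v $ j) = k * v $ i" if "i < m" for i
  proof -
    have "(?B *\<^sub>v v) $ i = (\<Sum>j<m. of_real (A $$ (i, j)) * v $ j)"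
      using A v(1) that by (auto simp: scalar_prod_def atLeast0LessThan intro!: sum.cong)
    then show ?thesis using v that by simp
  qed
  define N where "N = (\<Sum>i<m. (cmod (v $ i))\<^sup>2)"
  define q where "q = (\<Sum>i<m. \<Sum>j<m. cnj (v $ i) * of_real (A $$ (i, j)) * v $ j)"
  have "q = (\<Sum>i<m. cnj (v $ i) * (\<Sum>j<m. of_real (A $$ (i, j)) * v $ j))"
    by (simp add: q_def sum_distrib_left mult.assoc)
  also have "\<dots> = (\<Sum>i<m. cnj (v $ i) * (k * v $ i))"
    using Bv by (intro sum.cong) auto
  also have "\<dots> = (\<Sum>i<m. k * of_real ((cmod (v $ i))\<^sup>2))"
    by (intro sum.cong refl) (metis complex_norm_square mult.assoc mult.commute)
  also have "\<dots> = k * of_real N" by (simp add: N_def sum_distrib_left)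
  finally have q: "q = k * of_real N" .
  have "cnj q = (\<Sum>i<m. \<Sum>j<m. cnj (v $ j) * of_real (A $$ (i, j)) * v $ i)"
    by (simp add: q_def mult_ac)
  also have "\<dots> = (\<Sum>j<m. \<Sum>i<m. cnj (v $ j) * of_real (A $$ (i, j)) * v $ i)"
    by (rule sum.swap)
  also have "\<dots> = q"
    unfolding q_def using sym by (intro sum.cong refl) simp
  finally have "cnj k * of_real N = k * of_real N" using q by simp
  moreover have "N \<noteq> 0"
  proof
    assume "N = 0"
    then have "\<forall>i<m. v $ i = 0" by (simp add: N_def sum_nonneg_eq_0_iff)
    then have "v = 0\<^sub>v m" using v(1) by (intro eq_vecI) auto
    then show False using v(2) by simp
  qed
  ultimately show ?thesis by (simp add: Reals_cnj_iff)
qed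

lemma size_mat_eigenvalues:
  fixes A :: "real mat"
  assumes A: "A \<in> carrier_mat m m"
    and sym: "\<And>i j. i < m \<Longrightarrow> j < m \<Longrightarrow> A $$ (i, j) = A $$ (j, i)"
  shows "size (mat_eigenvalues A) = m"
proof -
  let ?B = "map_mat complex_of_real A"
  have B: "?B \<in> carrier_mat m m" using A by simp
  obtain as where as: "char_poly ?B = (\<Prod>a\<leftarrow>as. [:- a, 1:])" "length as = m"
    using char_poly_factorized[OF B] by auto
  have real: "a \<in> \<real>" if "a \<in> set as" for a
  proof (rule symmetric_eigenvalue_real[OF A sym])
    have "poly (char_poly ?B) a = 0"
      using that unfolding as(1) by (simp add: poly_prod_list o_def prod_list_zero_iff image_iff)
    then show "eigenvalue ?B a" using eigenvalue_root_char_poly[OF B] by simp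
  qed
  define p where "p = (\<Prod>a\<leftarrow>map Re as. [:- a, 1:])"
  interpret h: map_poly_inj_comm_ring_hom complex_of_real ..
  have "map_poly complex_of_real p = (\<Prod>a\<leftarrow>as. [:- of_real (Re a), 1:])"
    unfolding p_def by (simp add: h.hom_prod_list o_def)
  also have "\<dots> = char_poly ?B"
    unfolding as(1) using real by (intro arg_cong[of _ _ prod_list] map_cong) auto
  also have "\<dots> = map_poly complex_of_real (char_poly A)"
    by (rule of_real_hom.char_poly_hom[OF A])
  finally have "char_poly A = p" by simp
  moreover have "proots (\<Prod>a\<leftarrow>xs. [:- a, 1:]) = mset xs" for xs :: "real list"
  proof (induction xs)
    case (Cons x xs)
    have "(\<Prod>a\<leftarrow>xs. [:- a, 1:]) \<noteq> 0" by (auto simp: prod_list_zero_iff)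
    then show ?case using Cons by (simp add: proots_mult del: mult_pCons_left)
  qed simp
  ultimately show ?thesis
    unfolding mat_eigenvalues_def p_def using as(2) by (metis size_mset length_map)
qed

lemma adj_entry_commute: "adj_entry S u v = adj_entry S v u"
  by (simp add: adj_entry_def insert_commute)

lemma size_sg_eigenvalues: "size (sg_eigenvalues S) = card (sg_verts S)"
  unfolding sg_eigenvalues_def
proof (rule size_mat_eigenvalues)
  show "adjacency_matrix S \<in> carrier_mat (card (sg_verts S)) (card (sg_verts S))"
    by (simp add: adjacency_matrix_def vertex_matrix_def)
  show "adjacency_matrix S $$ (i, j) = adjacency_matrix S $$ (j, i)"
    if "i < card (sg_verts S)" "j < card (sg_verts S)" for i j
    using that adj_entry_commute[of S "vertex_list S ! i" "vertex_list S ! j"]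
    by (simp add: adjacency_matrix_def vertex_matrix_def)
qed

lemma size_sg_laplacian_eigenvalues: "size (sg_laplacian_eigenvalues S) = card (sg_verts S)"
  unfolding sg_laplacian_eigenvalues_def
proof (rule size_mat_eigenvalues)
  show "laplacian_matrix S \<in> carrier_mat (card (sg_verts S)) (card (sg_verts S))"
    by (simp add: laplacian_matrix_def degree_matrix_def adjacency_matrix_def vertex_matrix_def
        minus_carrier_mat)
  show "laplacian_matrix S $$ (i, j) = laplacian_matrix S $$ (j, i)"
    if "i < card (sg_verts S)" "j < card (sg_verts S)" for i j
    using that adj_entry_commute[of S "vertex_list S ! i" "vertex_list S ! j"]
    by (simp add: laplacian_matrix_def degree_matrix_def adjacency_matrix_def vertex_matrix_def)
qed

lemma handshake:
  assumes S: "signed_graph S" and reg: "regular_sgraph S k"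
  shows "2 * card (sg_edges S) = card (sg_verts S) * k"
proof -
  have "card (sg_verts S) * k = (\<Sum>v\<in>sg_verts S. card {e \<in> sg_edges S. v \<in> e})"
    using reg by (simp add: regular_sgraph_def degree_in_def)
  also have "\<dots> = (\<Sum>e\<in>sg_edges S. card {v \<in> sg_verts S. v \<in> e})"
    by (rule sum_multicount_gen[symmetric]) (use signed_graphD[OF S] in auto)
  also have "\<dots> = (\<Sum>e\<in>sg_edges S. 2)"
  proof (rule sum.cong)
    fix e assume e: "e \<in> sg_edges S"
    then have "{v \<in> sg_verts S. v \<in> e} = e" using signed_graphD(3)[OF S e] by auto
    then show "card {v \<in> sg_verts S. v \<in> e} = 2" using signed_graphD(4)[OF S e] by simp
  qed simp
  finally show ?thesis by simp
qed

text \<open>The number of eigenvalues of the line graph of a \<open>k\<close>-regular signed graph on \<open>n\<close> vertices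
  is therefore \<open>nk/2\<close>.  Besides the \<open>n\<close> eigenvalues coming from the graph itself there are
  \<open>nk/2 - n = n(k-2)/2\<close> additional ones (a deduction if \<open>k < 2\<close>), and not \<open>n(k-2)\<close>.  The theorem
  uses this corrected number, the energy contribution \<open>2 \<cdot> n(k-2)/2 = (k-2)n\<close> that results from
  it, and the value \<open>2(k-1) + 2(k-1) = 4k-4\<close> (not \<open>4k-6\<close>) for the Laplacian eigenvalue of the
  \<open>2(k-1)\<close>-regular line graph that belongs to its eigenvalue \<open>-2(k-1)\<close>.\<close>

end

theory Submission
  imports Defs "HOL-Combinatorics.Permutations"
begin

text \<open>Everything is read off from orthonormal eigenbases.  Products of eigenvectors of the factors
  form an eigenbasis of the Cartesian product, whose adjacency matrix is a Kronecker sum.  For a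
  \<open>k\<close>-regular signed graph, \<open>k I - A = H H\<^sup>T\<close>, while \<open>2 I - A(\<Lambda>) = H\<^sup>T H\<close>; these have the same
  nonzero eigenvalues with multiplicities, and the number of the remaining ones is found by
  counting edges.  The kernel of \<open>H\<^sup>T\<close> is spanned by the switching functions of the balanced
  components, so \<open>k\<close> has multiplicity \<open>b(\<Sigma>)\<close>.  As \<open>k\<close> is the largest possible eigenvalue, a sum of
  eigenvalues of the factors attains it only if every summand is maximal, whence the product
  formula for \<open>b(\<Sigma>)\<close>.  Replacing \<open>\<Sigma>\<close> by \<open>-\<Sigma>\<close> treats the lower end of the spectrum.\<close>

section \<open>Orthonormal eigenbases\<close>

text \<open>No multiplicity is computed as the dimension of an eigenspace or as a rank. It is the
  cardinality of an index set such as \<open>{i\<in>I. lam i = x}\<close>, and it is compared with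
  other cardinalities by evaluating one double sum of squared inner products in both orders.
  Identities of Parseval type evaluate it either way. This needs orthonormal bases, hence a spectral
  theorem for real symmetric matrices, obtained by deflation with reflections. Index sets are
  arbitrary, because the theorem prescribes the enumerations \<open>lam i\<close> and the
  eigenvectors of the product are indexed by the tuples in \<open>J\<close>. The delicate value is
  2: it corresponds to the eigenvalue 0 of the Gram matrices, where \<open>H H^T\<close> and
  \<open>H^T H\<close> need not agree. As \<open>H\<close> has n rows and nk/2 columns and the
  nonzero parts of the spectra coincide, the multiplicities of 0 differ by nk/2 - n = n(k-2)/2. This
  difference can be negative, so spectra are described by real-valued counts and not as unions of
  multisets.\<close>

text \<open>The reflection that exchanges \<open>v\<close> and the first unit vector.  If they are equal, then
  \<open>c = inverse 0 = 0\<close> and the formula for \<open>U\<close> gives the identity.\<close>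

lemma householder:
  fixes v :: "real vec"
  assumes v: "v \<in> carrier_vec (Suc n)" and norm: "(\<Sum>i<Suc n. (v $ i)\<^sup>2) = 1"
  obtains U where "U \<in> carrier_mat (Suc n) (Suc n)" "transpose_mat U = U"
    "U * U = 1\<^sub>m (Suc n)" "col U 0 = v"
proof -
  \<comment> \<open>For a unit vector \<open>v\<close> the difference \<open>d\<close> of the first
    unit vector and \<open>v\<close> has squared length \<open>2 - 2 * v $ 0\<close>. So
    \<open>c\<close> is the coefficient 2/|d|^2 of the reflection in the hyperplane orthogonal to
    \<open>d\<close>.\<close>
  define c where "c = inverse (1 - v $ 0)"
  define d where "d = (\<lambda>i. of_bool (i = 0) - v $ i)"
  define U where "U = mat (Suc n) (Suc n) (\<lambda>(i, j). of_bool (i = j) - c * d i * d j)"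
  have "(\<Sum>i<Suc n. (d i)\<^sup>2) = (\<Sum>i<Suc n. of_bool (i = 0) - 2 * (of_bool (i = 0) * v $ i) + (v $ i)\<^sup>2)"
    by (intro sum.cong) (auto simp: d_def power2_diff)
  also have "\<dots> = (\<Sum>i<Suc n. of_bool (i = 0)) - 2 * (\<Sum>i<Suc n. of_bool (i = 0) * v $ i) + 1"
    by (simp only: sum.distrib sum_subtractf sum_distrib_left norm)
  also have "\<dots> = 2 - 2 * v $ 0" by (simp add: sum.lessThan_Suc_shift del: sum.lessThan_Suc)
  finally have dd: "(\<Sum>i<Suc n. (d i)\<^sup>2) = 2 - 2 * v $ 0" .
  \<comment> \<open>Also true for \<open>v $ 0 = 1\<close>, where \<open>c = 0\<close>. The identity
    for \<open>c\<close> that follows cancels the coefficient of \<open>d i * d j\<close> in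
    \<open>U * U\<close>.\<close>
  have "c * (c * (1 - v $ 0)) = c" by (cases "v $ 0 = 1") (simp_all add: c_def)
  moreover have "c * c * (2 - 2 * v $ 0) = 2 * (c * (c * (1 - v $ 0)))" by (simp add: algebra_simps)
  ultimately have c: "c * c * (2 - 2 * v $ 0) = 2 * c" by (simp only:)
  show thesis
  proof
    show U: "U \<in> carrier_mat (Suc n) (Suc n)" by (simp add: U_def)
    show "transpose_mat U = U" by (rule eq_matI) (auto simp: U_def)
    show "U * U = 1\<^sub>m (Suc n)"
    proof (rule eq_matI)
      fix i j assume "i < dim_row (1\<^sub>m (Suc n) :: real mat)" "j < dim_col (1\<^sub>m (Suc n) :: real mat)"
      then have ij: "i < Suc n" "j < Suc n" by simp_all
      have "(U * U) $$ (i, j)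
          = (\<Sum>k<Suc n. (of_bool (i = k) - c * d i * d k) * (of_bool (k = j) - c * d k * d j))"
        using ij by (simp add: U_def scalar_prod_def atLeast0LessThan del: sum.lessThan_Suc)
      also have "\<dots> = (\<Sum>k<Suc n. of_bool (i = k) * of_bool (k = j) - c * d j * (of_bool (i = k) * d k)
          - c * d i * (of_bool (k = j) * d k) + c * c * d i * d j * (d k)\<^sup>2)"
        by (intro sum.cong) (auto simp: algebra_simps power2_eq_square)
      also have "\<dots> = of_bool (i = j) - 2 * c * d i * d j + c * c * d i * d j * (2 - 2 * v $ 0)"
        using ij by (simp only: sum.distrib sum_subtractf sum_distrib_left[symmetric] dd)
          (simp add: of_bool_def if_distrib[of "\<lambda>x. x * _"] sum.delta sum.delta' del: sum.lessThan_Suc cong: if_cong)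
      also have "\<dots> = of_bool (i = j) + (c * c * (2 - 2 * v $ 0) - 2 * c) * d i * d j"
        by (simp add: algebra_simps)
      finally show "(U * U) $$ (i, j) = 1\<^sub>m (Suc n) $$ (i, j)"
        using ij by (simp add: c)
    qed (simp_all add: U_def)
    show "col U 0 = v"
    proof (cases "v $ 0 = 1")
      case True
      have "(\<Sum>i<Suc n. (v $ i)\<^sup>2) = 1 + (\<Sum>i<n. (v $ Suc i)\<^sup>2)"
        using True by (simp add: sum.lessThan_Suc_shift del: sum.lessThan_Suc)
      then have "\<forall>i<n. v $ Suc i = 0" using norm by (simp add: sum_nonneg_eq_0_iff del: sum.lessThan_Suc)
      then have "v $ i = of_bool (i = 0)" if "i < Suc n" for i using that True by (cases i) auto
      then show ?thesis using v True by (intro eq_vecI) (auto simp: U_def c_def)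
    next
      case False
      then have "c * d 0 = 1" by (simp add: c_def d_def)
      then have "c * d i * d 0 = d i" for i by (metis mult.assoc mult.commute mult_1)
      then have "col U 0 $ i = of_bool (i = 0) - d i" if "i < Suc n" for i
        using that by (simp add: U_def)
      then show ?thesis using v U by (intro eq_vecI) (auto simp: d_def)
    qed
  qed
qed

text \<open>The characteristic polynomial splits over the reals, so in positive dimension it has a
  real root; an eigenvector for it is then normalized.\<close>

lemma symmetric_unit_eigenvector:
  fixes A :: "real mat"
  assumes A: "A \<in> carrier_mat (Suc n) (Suc n)" and sym: "transpose_mat A = A"
  obtains v e where "v \<in> carrier_vec (Suc n)" "(\<Sum>i<Suc n. (v $ i)\<^sup>2) = 1" "A *\<^sub>v v = e \<cdot>\<^sub>v v"
proof -
  have "A $$ (i, j) = A $$ (j, i)" if "i < Suc n" "j < Suc n" for i j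
    using arg_cong[OF sym, of "\<lambda>M. M $$ (j, i)"] A that by simp
  then have "size (mat_eigenvalues A) = Suc n" by (rule size_mat_eigenvalues[OF A])
  then obtain e where "e \<in># mat_eigenvalues A" by (metis size_eq_Suc_imp_elem)
  then have "poly (char_poly A) e = 0"
    unfolding mat_eigenvalues_def
    by (metis count_greater_zero_iff count_proots empty_iff less_numeral_extra(3) order_root proots_0
        set_mset_empty)
  then have "eigenvalue A e" using eigenvalue_root_char_poly[OF A] by simp
  then obtain w where w: "w \<in> carrier_vec (Suc n)" "w \<noteq> 0\<^sub>v (Suc n)" "A *\<^sub>v w = e \<cdot>\<^sub>v w"
    using A by (auto simp: eigenvalue_def eigenvector_def)
  define N where "N = (\<Sum>i<Suc n. (w $ i)\<^sup>2)"
  have "N \<noteq> 0"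
  proof
    assume "N = 0"
    then have "\<forall>i<Suc n. w $ i = 0" by (subst (asm) N_def) (auto simp: sum_nonneg_eq_0_iff simp del: sum.lessThan_Suc)
    then have "w = 0\<^sub>v (Suc n)" using w(1) by (intro eq_vecI) auto
    then show False using w(2) by simp
  qed
  moreover have "N \<ge> 0" unfolding N_def by (intro sum_nonneg) simp
  ultimately have N: "N > 0" by simp
  define v where "v = inverse (sqrt N) \<cdot>\<^sub>v w"
  show thesis
  proof
    show "v \<in> carrier_vec (Suc n)" using w by (simp add: v_def)
    have "(\<Sum>i<Suc n. (v $ i)\<^sup>2) = (\<Sum>i<Suc n. inverse N * (w $ i)\<^sup>2)"
      using w(1) N by (intro sum.cong) (auto simp: v_def power_mult_distrib power_inverse)
    also have "\<dots> = inverse N * N" unfolding N_def by (simp only: sum_distrib_left)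
    finally show "(\<Sum>i<Suc n. (v $ i)\<^sup>2) = 1" using N by simp
    show "A *\<^sub>v v = e \<cdot>\<^sub>v v" using A w
      by (simp add: v_def mult_mat_vec smult_smult_assoc mult.commute)
  qed
qed

text \<open>Deflation: conjugation by a reflection \<open>U\<close> whose first column is a unit
  eigenvector turns the first column of \<open>M\<close> into a multiple of the first unit vector.
  By symmetry the first row is cleared too, and the induction hypothesis applies to the block
  \<open>M4\<close>. The basis is \<open>U * P0\<close>.\<close>

lemma symmetric_diagonalization:
  fixes A :: "real mat"
  assumes "A \<in> carrier_mat n n" "transpose_mat A = A"
  shows "\<exists>P D. P \<in> carrier_mat n n \<and> D \<in> carrier_mat n n \<and> diagonal_mat D
    \<and> transpose_mat P * P = 1\<^sub>m n \<and> A * P = P * D"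
  using assms
proof (induction n arbitrary: A)
  case 0
  have "transpose_mat (1\<^sub>m 0) * 1\<^sub>m 0 = (1\<^sub>m 0 :: real mat)" "A * 1\<^sub>m 0 = 1\<^sub>m 0 * A"
    using 0 by (auto intro!: eq_matI)
  then show ?case using 0 by (intro exI[of _ "1\<^sub>m 0"] exI[of _ A]) (auto simp: diagonal_mat_def)
next
  case (Suc n)
  note A = Suc.prems(1)
  obtain v e where v: "v \<in> carrier_vec (Suc n)" "(\<Sum>i<Suc n. (v $ i)\<^sup>2) = 1" "A *\<^sub>v v = e \<cdot>\<^sub>v v"
    using symmetric_unit_eigenvector[OF Suc.prems] by metis
  obtain U where U: "U \<in> carrier_mat (Suc n) (Suc n)" "transpose_mat U = U"
    "U * U = 1\<^sub>m (Suc n)" "col U 0 = v"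
    using householder[OF v(1,2)] by metis
  define M where "M = U * A * U"
  have M: "M \<in> carrier_mat (Suc n) (Suc n)" using A U by (simp add: M_def)
  have Msym: "transpose_mat M = M"
    using A U Suc.prems(2) by (simp add: M_def transpose_mult[of _ "Suc n" "Suc n" _ "Suc n"]
        assoc_mult_mat[of _ "Suc n" "Suc n" _ "Suc n" _ "Suc n"])
  have "col M 0 = U *\<^sub>v (A *\<^sub>v v)"
  proof -
    have "M = U * (A * U)" unfolding M_def by (rule assoc_mult_mat[OF U(1) A U(1)])
    then have "col M 0 = U *\<^sub>v col (A * U) 0"
      using col_mult2[OF U(1), of "A * U" "Suc n" 0] A U(1) by simp
    also have "col (A * U) 0 = A *\<^sub>v v"
      using col_mult2[OF A U(1), of 0] U(4) by simp
    finally show ?thesis .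
  qed
  also have "\<dots> = e \<cdot>\<^sub>v (U *\<^sub>v v)" using v U by (simp add: mult_mat_vec)
  \<comment> \<open>\<open>v\<close> is the first column of \<open>U\<close>, so \<open>U\<close>
    sends it to the first column of \<open>U * U\<close>, the identity.\<close>
  also have "U *\<^sub>v v = col (U * U) 0" using U by (subst col_mult2[of _ "Suc n" "Suc n" _ "Suc n"]) auto
  also have "\<dots> = unit_vec (Suc n) 0" using U by simp
  finally have col0: "col M 0 = e \<cdot>\<^sub>v unit_vec (Suc n) 0" .
  obtain M1 M2 M3 M4 where sb: "split_block M 1 1 = (M1, M2, M3, M4)" by (metis prod_cases4)
  note sp = split_block[OF sb, of n n]
  have M14: "M1 \<in> carrier_mat 1 1" "M2 \<in> carrier_mat 1 n" "M3 \<in> carrier_mat n 1" "M4 \<in> carrier_mat n n"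
    and Mblock: "M = four_block_mat M1 M2 M3 M4" using sp M by auto
  have symE: "M $$ (i, j) = M $$ (j, i)" if "i < Suc n" "j < Suc n" for i j
    using arg_cong[OF Msym, of "\<lambda>M. M $$ (j, i)"] M that by simp
  have M0: "M $$ (i, 0) = 0" if "0 < i" "i < Suc n" for i
    using arg_cong[OF col0, of "\<lambda>v. v $ i"] M that by (simp add: unit_vec_def)
  have M2: "M2 = 0\<^sub>m 1 n"
  proof (rule eq_matI)
    fix i j assume "i < dim_row (0\<^sub>m 1 n :: real mat)" "j < dim_col (0\<^sub>m 1 n :: real mat)"
    then show "M2 $$ (i, j) = 0\<^sub>m 1 n $$ (i, j)"
      using M0[of "Suc j"] symE[of 0 "Suc j"] M14 unfolding Mblock by simp
  qed (use M14 in auto)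
  have M3: "M3 = 0\<^sub>m n 1"
  proof (rule eq_matI)
    fix i j assume "i < dim_row (0\<^sub>m n 1 :: real mat)" "j < dim_col (0\<^sub>m n 1 :: real mat)"
    then show "M3 $$ (i, j) = 0\<^sub>m n 1 $$ (i, j)"
      using M0[of "Suc i"] M14 unfolding Mblock by simp
  qed (use M14 in auto)
  have "transpose_mat M4 = M4"
  proof (rule eq_matI)
    fix i j assume "i < dim_row M4" "j < dim_col M4"
    then show "transpose_mat M4 $$ (i, j) = M4 $$ (i, j)"
      using symE[of "Suc i" "Suc j"] M14 unfolding Mblock by simp
  qed (use M14 in auto)
  from Suc.IH[OF M14(4) this] obtain P' D' where P': "P' \<in> carrier_mat n n" "D' \<in> carrier_mat n n"
    "diagonal_mat D'" "transpose_mat P' * P' = 1\<^sub>m n" "M4 * P' = P' * D'" by blast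
  define P0 where "P0 = four_block_mat (1\<^sub>m 1) (0\<^sub>m 1 n) (0\<^sub>m n 1) P'"
  define D where "D = four_block_mat M1 (0\<^sub>m 1 n) (0\<^sub>m n 1) D'"
  have P0: "P0 \<in> carrier_mat (Suc n) (Suc n)" and D: "D \<in> carrier_mat (Suc n) (Suc n)"
    using P' M14 four_block_carrier_mat[of "1\<^sub>m 1" 1 1 P' n n "0\<^sub>m 1 n" "0\<^sub>m n 1"]
      four_block_carrier_mat[of M1 1 1 D' n n "0\<^sub>m 1 n" "0\<^sub>m n 1"] by (simp_all add: P0_def D_def)
  have "M * P0 = P0 * D"
    unfolding Mblock M2 M3 P0_def D_def using P' M14
    by (simp add: mult_four_block_mat[of _ 1 1 _ n _ n _ _ 1 _ n])
  moreover have P0T: "transpose_mat P0 * P0 = 1\<^sub>m (Suc n)"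
    unfolding P0_def using P'
    by (simp add: transpose_four_block_mat[of _ 1 1 _ n _ n] mult_four_block_mat[of _ 1 1 _ n _ n _ _ 1 _ n])
  moreover have "diagonal_mat D"
    using P' M14 unfolding D_def diagonal_mat_def by auto
  moreover have "A * (U * P0) = U * (M * P0)"
  proof -
    have X: "A * (U * P0) \<in> carrier_mat (Suc n) (Suc n)" using A U P0 by simp
    have "U * (M * P0) = U * (U * (A * (U * P0)))"
      using A U P0 unfolding M_def
      by (simp add: assoc_mult_mat[of _ "Suc n" "Suc n" _ "Suc n" _ "Suc n"] del: U(3))
    also have "\<dots> = (U * U) * (A * (U * P0))"
      by (rule assoc_mult_mat[OF U(1) U(1) X, symmetric])
    finally show ?thesis by (simp only: U(3) left_mult_one_mat[OF X])
  qed
  moreover have "transpose_mat (U * P0) * (U * P0) = 1\<^sub>m (Suc n)"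
  proof -
    have "transpose_mat (U * P0) * (U * P0) = transpose_mat P0 * (U * (U * P0))"
      using U P0 by (simp add: transpose_mult[of _ "Suc n" "Suc n" _ "Suc n"]
          assoc_mult_mat[of _ "Suc n" "Suc n" _ "Suc n" _ "Suc n"] del: U(3))
    also have "U * (U * P0) = (U * U) * P0"
      by (rule assoc_mult_mat[OF U(1) U(1) P0, symmetric])
    finally show ?thesis using P0 P0T U(3) by simp
  qed
  ultimately show ?case using U P0 D A
    by (intro exI[of _ "U * P0"] exI[of _ D])
      (simp add: assoc_mult_mat[of _ "Suc n" "Suc n" _ "Suc n" _ "Suc n"])
qed

text \<open>An orthogonal matrix diagonalizing \<open>f\<close>, with rows indexed by
  \<open>V\<close> and columns by any finite set \<open>I\<close>. Of the two orthogonality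
  relations the last one is completeness, the source of Parseval's identity. Values outside
  \<open>V\<close> are unconstrained.\<close>

definition eigenbasis ::
    "'v set \<Rightarrow> ('v \<Rightarrow> 'v \<Rightarrow> real) \<Rightarrow> 'i set \<Rightarrow> ('i \<Rightarrow> real) \<Rightarrow> ('i \<Rightarrow> 'v \<Rightarrow> real) \<Rightarrow> bool" where
  "eigenbasis V f I lam \<phi> \<longleftrightarrow> finite V \<and> finite I
     \<and> (\<forall>i\<in>I. \<forall>u\<in>V. (\<Sum>v\<in>V. f u v * \<phi> i v) = lam i * \<phi> i u)
     \<and> (\<forall>i\<in>I. \<forall>j\<in>I. (\<Sum>v\<in>V. \<phi> i v * \<phi> j v) = of_bool (i = j))
     \<and> (\<forall>u\<in>V. \<forall>v\<in>V. (\<Sum>i\<in>I. \<phi> i u * \<phi> i v) = of_bool (u = v))"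

lemma eigenbasisD:
  assumes "eigenbasis V f I lam \<phi>"
  shows "finite V" "finite I"
    and "\<And>i u. i \<in> I \<Longrightarrow> u \<in> V \<Longrightarrow> (\<Sum>v\<in>V. f u v * \<phi> i v) = lam i * \<phi> i u"
    and "\<And>i j. i \<in> I \<Longrightarrow> j \<in> I \<Longrightarrow> (\<Sum>v\<in>V. \<phi> i v * \<phi> j v) = of_bool (i = j)"
    and "\<And>u v. u \<in> V \<Longrightarrow> v \<in> V \<Longrightarrow> (\<Sum>i\<in>I. \<phi> i u * \<phi> i v) = of_bool (u = v)"
  using assms unfolding eigenbasis_def by blast+

text \<open>The sum of all \<open>(\<phi> i v)\<^sup>2\<close> is \<open>card I\<close> by
  orthonormality and \<open>card V\<close> by completeness.\<close>

lemma eigenbasis_card: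
  assumes B: "eigenbasis V f I lam \<phi>"
  shows "card I = card V"
proof -
  have "real (card I) = (\<Sum>i\<in>I. \<Sum>v\<in>V. \<phi> i v * \<phi> i v)" using eigenbasisD(4)[OF B] by simp
  also have "\<dots> = (\<Sum>v\<in>V. \<Sum>i\<in>I. \<phi> i v * \<phi> i v)" by (rule sum.swap)
  also have "\<dots> = real (card V)" using eigenbasisD(5)[OF B] by simp
  finally show ?thesis by simp
qed

lemma vertex_list:
  assumes "finite (sg_verts S)"
  shows "distinct (vertex_list S)" "set (vertex_list S) = sg_verts S"
    "length (vertex_list S) = card (sg_verts S)"
proof -
  have "distinct (vertex_list S) \<and> set (vertex_list S) = sg_verts S"
    unfolding vertex_list_def by (rule someI_ex) (metis assms finite_distinct_list)
  then show "distinct (vertex_list S)" "set (vertex_list S) = sg_verts S"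
    "length (vertex_list S) = card (sg_verts S)"
    by (auto simp: distinct_card[symmetric])
qed

lemma sum_nth:
  assumes "distinct xs"
  shows "(\<Sum>i<length xs. g (xs ! i)) = sum g (set xs)"
  using sum.reindex_bij_betw[OF bij_betw_nth[OF assms refl refl], of g] by simp

lemma proots_linear_factors: "proots (\<Prod>a\<leftarrow>xs. [:- a, 1:]) = mset xs" for xs :: "real list"
proof (induction xs)
  case (Cons x xs)
  have "(\<Prod>a\<leftarrow>xs. [:- a, 1:]) \<noteq> 0" by (auto simp: prod_list_zero_iff)
  then show ?case using Cons by (simp add: proots_mult del: mult_pCons_left)
qed simp

lemma eigenbasis_exists:
  assumes fin: "finite V" and sym: "\<And>u v. u \<in> V \<Longrightarrow> v \<in> V \<Longrightarrow> f u v = f v u"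
  shows "\<exists>lam \<phi>. eigenbasis V f {..<card V} lam \<phi>"
proof -
  obtain vs where vs: "distinct vs" "set vs = V" using finite_distinct_list[OF fin] by blast
  define n where "n = card V"
  have n: "length vs = n" using vs distinct_card n_def by metis
  define A where "A = mat n n (\<lambda>(i, j). f (vs ! i) (vs ! j))"
  have A: "A \<in> carrier_mat n n" by (simp add: A_def)
  have "transpose_mat A = A"
    using vs n by (intro eq_matI) (auto simp: A_def intro!: sym)
  from symmetric_diagonalization[OF A this] obtain P D where
    P: "P \<in> carrier_mat n n" and D: "D \<in> carrier_mat n n" "diagonal_mat D"
    and PTP: "transpose_mat P * P = 1\<^sub>m n" and AP: "A * P = P * D" by blast
  \<comment> \<open>A left inverse of a square matrix is a right inverse; this is what yields
    completeness.\<close>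
  have PPT: "P * transpose_mat P = 1\<^sub>m n"
    using mat_mult_left_right_inverse[OF _ P PTP] P by simp
  define ix where "ix = the_inv_into {..<n} ((!) vs)"
  have bij: "bij_betw ((!) vs) {..<n} V" using bij_betw_nth[OF vs(1)] vs n by simp
  have ix: "ix v < n" "vs ! ix v = v" if "v \<in> V" for v
    using that bij f_the_inv_into_f_bij_betw[OF bij] the_inv_into_into[OF bij_betw_imp_inj_on[OF bij]]
    unfolding ix_def bij_betw_def by auto
  have ixnth: "ix (vs ! i) = i" if "i < n" for i
    using that bij unfolding ix_def bij_betw_def by (simp add: the_inv_into_f_f)
  have sumV: "sum g V = (\<Sum>i<n. g (vs ! i))" for g :: "'a \<Rightarrow> real"
    using sum_nth[OF vs(1), of g] vs n by simp
  define \<phi> where "\<phi> = (\<lambda>i v. P $$ (ix v, i))"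
  have "eigenbasis V f {..<n} (\<lambda>i. D $$ (i, i)) \<phi>"
    unfolding eigenbasis_def
  proof (intro conjI ballI)
    fix i u assume i: "i \<in> {..<n}" and u: "u \<in> V"
    have "(\<Sum>v\<in>V. f u v * \<phi> i v) = (A * P) $$ (ix u, i)"
      using i ix[OF u] A P by (simp add: sumV \<phi>_def ixnth scalar_prod_def atLeast0LessThan A_def)
    also have "\<dots> = (\<Sum>k<n. P $$ (ix u, k) * D $$ (k, i))"
      unfolding AP using i ix[OF u] D P by (simp add: scalar_prod_def atLeast0LessThan)
    also have "\<dots> = (\<Sum>k<n. if k = i then P $$ (ix u, k) * D $$ (k, i) else 0)"
      using D i by (intro sum.cong) (auto simp: diagonal_mat_def)
    finally show "(\<Sum>v\<in>V. f u v * \<phi> i v) = D $$ (i, i) * \<phi> i u"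
      using i by (simp add: \<phi>_def)
  next
    fix i j assume ij: "i \<in> {..<n}" "j \<in> {..<n}"
    have "(\<Sum>v\<in>V. \<phi> i v * \<phi> j v) = (transpose_mat P * P) $$ (i, j)"
      using ij P by (simp add: sumV \<phi>_def ixnth scalar_prod_def atLeast0LessThan)
    then show "(\<Sum>v\<in>V. \<phi> i v * \<phi> j v) = of_bool (i = j)" using ij by (simp add: PTP)
  next
    fix u v assume uv: "u \<in> V" "v \<in> V"
    have "(\<Sum>i<n. \<phi> i u * \<phi> i v) = (P * transpose_mat P) $$ (ix u, ix v)"
      using ix uv P by (simp add: \<phi>_def scalar_prod_def atLeast0LessThan)
    moreover have "ix u = ix v \<longleftrightarrow> u = v" using ix uv by metis
    ultimately show "(\<Sum>i<n. \<phi> i u * \<phi> i v) = of_bool (u = v)" using uv ix by (simp add: PPT)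
  qed (use fin in auto)
  then show ?thesis unfolding n_def by blast
qed

text \<open>The bridge to spectra: the basis makes the matrix similar to a diagonal one, and similar
  matrices share their characteristic polynomial.\<close>

lemma eigenbasis_mat_eigenvalues:
  assumes B: "eigenbasis (sg_verts S) f I lam \<phi>"
  shows "mat_eigenvalues (vertex_matrix S f) = image_mset lam (mset_set I)"
proof -
  define V where "V = sg_verts S"
  define vs where "vs = vertex_list S"
  define n where "n = card V"
  note B' = eigenbasisD[OF B, folded V_def]
  have vs: "distinct vs" "set vs = V" "length vs = n"
    using vertex_list B'(1) unfolding vs_def V_def n_def by blast+
  obtain js where js: "distinct js" "set js = I" using finite_distinct_list[OF B'(2)] by blast
  have isn: "length js = n"
    using js eigenbasis_card[OF B] distinct_card unfolding n_def V_def by metis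
  have sumV: "sum g V = (\<Sum>i<n. g (vs ! i))" for g :: "'a \<Rightarrow> real"
    using sum_nth[OF vs(1), of g] vs by simp
  define A where "A = vertex_matrix S f"
  define P where "P = mat n n (\<lambda>(a, b). \<phi> (js ! b) (vs ! a))"
  define D where "D = mat n n (\<lambda>(a, b). if a = b then lam (js ! a) else 0)"
  have A: "A = mat n n (\<lambda>(a, b). f (vs ! a) (vs ! b))"
    by (simp add: A_def vertex_matrix_def n_def V_def vs_def)
  have carr: "A \<in> carrier_mat n n" "P \<in> carrier_mat n n" "D \<in> carrier_mat n n"
    by (simp_all add: A P_def D_def)
  have in_V: "vs ! a \<in> V" if "a < n" for a using that vs by (metis nth_mem)
  have in_I: "js ! a \<in> I" if "a < n" for a using that js isn by (metis nth_mem)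
  have PTP: "transpose_mat P * P = 1\<^sub>m n"
  proof (rule eq_matI)
    fix a b assume "a < dim_row (1\<^sub>m n :: real mat)" "b < dim_col (1\<^sub>m n :: real mat)"
    then have ab: "a < n" "b < n" by simp_all
    have "(transpose_mat P * P) $$ (a, b) = (\<Sum>v\<in>V. \<phi> (js ! a) v * \<phi> (js ! b) v)"
      using ab by (simp add: P_def scalar_prod_def atLeast0LessThan sumV)
    also have "\<dots> = of_bool (a = b)"
      using B'(4)[OF in_I[OF ab(1)] in_I[OF ab(2)]] js isn ab by (simp add: nth_eq_iff_index_eq)
    finally show "(transpose_mat P * P) $$ (a, b) = 1\<^sub>m n $$ (a, b)" using ab by simp
  qed (simp_all add: P_def)
  have PPT: "P * transpose_mat P = 1\<^sub>m n"
    using mat_mult_left_right_inverse[OF _ carr(2) PTP] carr by simp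
  have AP: "A * P = P * D"
  proof (rule eq_matI)
    fix a b assume "a < dim_row (P * D)" "b < dim_col (P * D)"
    then have ab: "a < n" "b < n" using carr by simp_all
    have "(A * P) $$ (a, b) = (\<Sum>v\<in>V. f (vs ! a) v * \<phi> (js ! b) v)"
      using ab by (simp add: A P_def scalar_prod_def atLeast0LessThan sumV)
    also have "\<dots> = lam (js ! b) * \<phi> (js ! b) (vs ! a)" using B'(3) in_I in_V ab by simp
    also have "\<dots> = (P * D) $$ (a, b)"
      using ab by (simp add: P_def D_def scalar_prod_def atLeast0LessThan if_distrib[of "\<lambda>x. _ * x"] sum.delta cong: if_cong)
    finally show "(A * P) $$ (a, b) = (P * D) $$ (a, b)" .
  qed (use carr in auto)
  have "A = A * (P * transpose_mat P)" using carr by (simp add: PPT)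
  also have "\<dots> = P * D * transpose_mat P"
    using carr AP by (metis assoc_mult_mat transpose_carrier_mat)
  finally have "similar_mat A D"
    using carr PTP PPT by (intro similar_matI[of A D P "transpose_mat P" n]) auto
  then have "char_poly A = char_poly D" by (rule char_poly_similar)
  also have "\<dots> = (\<Prod>a\<leftarrow>diag_mat D. [:- a, 1:])"
    by (rule char_poly_upper_triangular[OF carr(3)]) (auto simp: D_def)
  also have "diag_mat D = map lam js"
    using isn by (intro nth_equalityI) (auto simp: diag_mat_def D_def)
  finally have "mat_eigenvalues A = mset (map lam js)"
    unfolding mat_eigenvalues_def by (simp only: proots_linear_factors)
  then show ?thesis using js mset_set_set[OF js(1)] by (simp add: A_def)
qed

text \<open>Any bijection \<open>h\<close> moves the second family to \<open>I\<close>; two families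
  over the same set with equal multisets of values differ by a permutation of it.\<close>

lemma image_mset_eq_imp_bij_betw:
  assumes fin: "finite I" "finite I'"
    and eq: "image_mset f (mset_set I) = image_mset g (mset_set I')"
  obtains p where "bij_betw p I I'" "\<And>i. i \<in> I \<Longrightarrow> g (p i) = f i"
proof -
  have "card I = card I'" using arg_cong[OF eq, of size] by simp
  then obtain h where h: "bij_betw h I I'" using finite_same_card_bij[OF fin] by blast
  have "image_mset g (mset_set I') = image_mset (g \<circ> h) (mset_set I)"
    using h image_mset_mset_set[of h I] by (auto simp: bij_betw_def multiset.map_comp[symmetric])
  then obtain p where p: "p permutes I" "\<forall>i\<in>I. f i = (g \<circ> h) (p i)"
    using image_mset_eq_implies_permutes[OF fin(1), of f "g \<circ> h"] eq by metis
  have "bij_betw (h \<circ> p) I I'" using p(1) h by (meson bij_betw_trans permutes_imp_bij)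
  then show thesis using p(2) by (intro that[of "h \<circ> p"]) auto
qed

lemma eigenbasis_reindex:
  assumes B: "eigenbasis V f I' lam' \<phi>" and p: "bij_betw p I I'"
    and lam: "\<And>i. i \<in> I \<Longrightarrow> lam' (p i) = lam i"
  shows "eigenbasis V f I lam (\<lambda>i. \<phi> (p i))"
proof -
  note B' = eigenbasisD[OF B]
  have pI: "p i \<in> I'" if "i \<in> I" for i using p that by (auto simp: bij_betw_def)
  have inj: "p i = p j \<longleftrightarrow> i = j" if "i \<in> I" "j \<in> I" for i j
    using p that by (auto simp: bij_betw_def inj_on_def)
  show ?thesis
    unfolding eigenbasis_def
    using B' p pI inj lam bij_betw_finite[OF p]
      sum.reindex_bij_betw[OF p, of "\<lambda>i. \<phi> i _ * \<phi> i _"] by auto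
qed

text \<open>Diagonalization delivers the eigenvalues in an order of its own. Here the eigenvectors
  are rearranged to fit a prescribed enumeration \<open>lam\<close> of the spectrum.\<close>

lemma eigenbasis_of_eigenvalues:
  assumes fin: "finite (sg_verts S)" "finite I"
    and sym: "\<And>u v. f u v = f v u"
    and lam: "image_mset lam (mset_set I) = mat_eigenvalues (vertex_matrix S f)"
  obtains \<phi> where "eigenbasis (sg_verts S) f I lam \<phi>"
proof -
  obtain lam' \<phi> where B: "eigenbasis (sg_verts S) f {..<card (sg_verts S)} lam' \<phi>"
    using eigenbasis_exists[of "sg_verts S" f] fin sym by blast
  then have "image_mset lam (mset_set I) = image_mset lam' (mset_set {..<card (sg_verts S)})"
    using eigenbasis_mat_eigenvalues[OF B] lam by simp
  from image_mset_eq_imp_bij_betw[OF fin(2) _ this]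
  obtain p where "bij_betw p I {..<card (sg_verts S)}" "\<And>i. i \<in> I \<Longrightarrow> lam' (p i) = lam i" by auto
  from eigenbasis_reindex[OF B this] show thesis by (rule that)
qed

section \<open>Kronecker sums and Gram matrices\<close>

text \<open>After expansion of the square, summing over \<open>i\<close> first leaves the
  completeness relation.\<close>

lemma parseval:
  assumes B: "eigenbasis V f I lam \<phi>"
  shows "(\<Sum>i\<in>I. (\<Sum>v\<in>V. x v * \<phi> i v)\<^sup>2) = (\<Sum>v\<in>V. (x v)\<^sup>2)"
proof -
  note B' = eigenbasisD[OF B]
  have "(\<Sum>i\<in>I. (\<Sum>v\<in>V. x v * \<phi> i v)\<^sup>2)
      = (\<Sum>i\<in>I. \<Sum>u\<in>V. \<Sum>v\<in>V. x u * x v * (\<phi> i u * \<phi> i v))"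
    by (simp add: power2_eq_square sum_product mult_ac)
  also have "\<dots> = (\<Sum>u\<in>V. \<Sum>i\<in>I. \<Sum>v\<in>V. x u * x v * (\<phi> i u * \<phi> i v))" by (rule sum.swap)
  also have "\<dots> = (\<Sum>u\<in>V. \<Sum>v\<in>V. \<Sum>i\<in>I. x u * x v * (\<phi> i u * \<phi> i v))"
    by (intro sum.cong refl sum.swap)
  also have "\<dots> = (\<Sum>u\<in>V. \<Sum>v\<in>V. x u * x v * of_bool (u = v))"
    using B'(5) by (intro sum.cong refl) (simp flip: sum_distrib_left)
  also have "\<dots> = (\<Sum>u\<in>V. \<Sum>v\<in>V. if u = v then x u * x v else 0)"
    by (intro sum.cong refl) auto
  finally show ?thesis using B'(1) by (simp add: power2_eq_square)
qed

text \<open>The eigenvectors are unchanged. This serves the Gram matrices \<open>k I - A\<close> and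
  \<open>2 I - A(\<Lambda>)\<close>, the negated graph, the Laplacian of a regular graph, and the
  mere replacement of \<open>f\<close> by a function agreeing with it on \<open>V\<close>.\<close>

lemma eigenbasis_affine:
  assumes B: "eigenbasis V f I lam \<phi>"
    and g: "\<And>u v. u \<in> V \<Longrightarrow> v \<in> V \<Longrightarrow> g u v = a * of_bool (u = v) + b * f u v"
  shows "eigenbasis V g I (\<lambda>i. a + b * lam i) \<phi>"
proof -
  note B' = eigenbasisD[OF B]
  have "(\<Sum>v\<in>V. g u v * \<phi> i v) = (a + b * lam i) * \<phi> i u" if "i \<in> I" "u \<in> V" for i u
  proof -
    have "(\<Sum>v\<in>V. g u v * \<phi> i v)
        = (\<Sum>v\<in>V. (if u = v then a * \<phi> i v else 0) + b * (f u v * \<phi> i v))"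
      using that g by (intro sum.cong refl) (auto simp: algebra_simps)
    also have "\<dots> = a * \<phi> i u + b * (lam i * \<phi> i u)"
      using that B' by (simp add: sum.distrib flip: sum_distrib_left)
    finally show ?thesis by (simp add: algebra_simps)
  qed
  then show ?thesis using B' unfolding eigenbasis_def by blast
qed

text \<open>The entries of the sum over \<open>i\<close> of the tensor products with
  \<open>f i\<close> in position \<open>i\<close> and identity matrices elsewhere. Each summand is
  written as a product over all coordinates, so that sums over \<open>PiE\<close> factor.\<close>

definition kronecker_sum ::
    "'n set \<Rightarrow> ('n \<Rightarrow> 'v \<Rightarrow> 'v \<Rightarrow> real) \<Rightarrow> ('n \<Rightarrow> 'v) \<Rightarrow> ('n \<Rightarrow> 'v) \<Rightarrow> real" where
  "kronecker_sum N f x y =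
     (\<Sum>i\<in>N. \<Prod>j\<in>N. if j = i then f j (x j) (y j) else of_bool (x j = y j))"

lemma prod_of_bool:
  "finite N \<Longrightarrow> (\<Prod>j\<in>N. of_bool (P j)) = (of_bool (\<forall>j\<in>N. P j) :: real)"
  by (induction N rule: finite_induct) auto

lemma prod_if_eq:
  assumes "finite N" "i \<in> N"
  shows "(\<Prod>l\<in>N. if l = i then a l else b l) = a i * (\<Prod>l\<in>N - {i}. b l)"
  using assms by (subst prod.remove[of N i]) (auto intro!: arg_cong2[where f = "(*)"] prod.cong)

text \<open>Applied to a product function, every summand is a product over the coordinates, and the
  distributive law turns the sum over tuples into a product of sums. Eigenvectors are one choice of
  \<open>h\<close>; \<open>h = 1\<close> gives row sums, hence degrees.\<close>

lemma sum_kronecker_sum: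
  assumes N: "finite N" "\<And>i. i \<in> N \<Longrightarrow> finite (V i)"
  shows "(\<Sum>y\<in>PiE N V. kronecker_sum N f x y * (\<Prod>l\<in>N. h l (y l)))
    = (\<Sum>i\<in>N. \<Prod>l\<in>N. \<Sum>v\<in>V l. (if l = i then f l (x l) v else of_bool (x l = v)) * h l v)"
proof -
  have "(\<Sum>y\<in>PiE N V. kronecker_sum N f x y * (\<Prod>l\<in>N. h l (y l)))
    = (\<Sum>y\<in>PiE N V. \<Sum>i\<in>N. \<Prod>l\<in>N. (if l = i then f l (x l) (y l) else of_bool (x l = y l)) * h l (y l))"
    by (simp add: kronecker_sum_def sum_distrib_right prod.distrib)
  also have "\<dots> = (\<Sum>i\<in>N. \<Sum>y\<in>PiE N V. \<Prod>l\<in>N. (if l = i then f l (x l) (y l) else of_bool (x l = y l)) * h l (y l))"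
    by (rule sum.swap)
  finally show ?thesis by (subst prod_sum_PiE) (use N in auto)
qed

text \<open>All three conditions factor over the coordinates. In the summand \<open>i\<close> of the
  eigenvalue equation, coordinate \<open>i\<close> contributes its eigenvalue and the others
  contribute 1.\<close>

lemma eigenbasis_kronecker_sum:
  assumes N: "finite N" and B: "\<And>i. i \<in> N \<Longrightarrow> eigenbasis (V i) (f i) (I i) (lam i) (\<phi> i)"
  shows "eigenbasis (PiE N V) (kronecker_sum N f) (PiE N I)
    (\<lambda>j. \<Sum>i\<in>N. lam i (j i)) (\<lambda>j x. \<Prod>i\<in>N. \<phi> i (j i) (x i))"
proof -
  note B' = eigenbasisD[OF B]
  show ?thesis
    unfolding eigenbasis_def
  proof (intro conjI ballI)
    show "finite (PiE N V)" "finite (PiE N I)" using N B' by (auto intro!: finite_PiE)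
  next
    fix j x assume j: "j \<in> PiE N I" and x: "x \<in> PiE N V"
    have ji: "j i \<in> I i" "x i \<in> V i" if "i \<in> N" for i using j x that by (auto dest: PiE_mem)
    have "(\<Sum>y\<in>PiE N V. kronecker_sum N f x y * (\<Prod>l\<in>N. \<phi> l (j l) (y l)))
      = (\<Sum>i\<in>N. \<Prod>l\<in>N. \<Sum>v\<in>V l. (if l = i then f l (x l) v else of_bool (x l = v)) * \<phi> l (j l) v)"
      by (rule sum_kronecker_sum) (use N B' in auto)
    also have "\<dots> = (\<Sum>i\<in>N. \<Prod>l\<in>N. (if l = i then lam l (j l) else 1) * \<phi> l (j l) (x l))"
    proof (intro sum.cong prod.cong refl)
      fix i l assume l: "l \<in> N"
      have "(\<Sum>v\<in>V l. of_bool (x l = v) * \<phi> l (j l) v) = (\<Sum>v\<in>V l. if x l = v then \<phi> l (j l) v else 0)"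
        by (intro sum.cong refl) auto
      then show "(\<Sum>v\<in>V l. (if l = i then f l (x l) v else of_bool (x l = v)) * \<phi> l (j l) v)
          = (if l = i then lam l (j l) else 1) * \<phi> l (j l) (x l)"
        using B'(1)[OF l] B'(3)[OF l ji[OF l]] ji[OF l] by (cases "l = i") auto
    qed
    also have "\<dots> = (\<Sum>i\<in>N. lam i (j i) * (\<Prod>l\<in>N. \<phi> l (j l) (x l)))"
      using N by (intro sum.cong refl) (simp add: prod.distrib prod_if_eq)
    finally show "(\<Sum>y\<in>PiE N V. kronecker_sum N f x y * (\<Prod>l\<in>N. \<phi> l (j l) (y l)))
      = (\<Sum>i\<in>N. lam i (j i)) * (\<Prod>l\<in>N. \<phi> l (j l) (x l))"
      by (simp add: sum_distrib_right)
  next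
    fix j j' assume j: "j \<in> PiE N I" "j' \<in> PiE N I"
    have "(\<Sum>x\<in>PiE N V. (\<Prod>i\<in>N. \<phi> i (j i) (x i)) * (\<Prod>i\<in>N. \<phi> i (j' i) (x i)))
        = (\<Prod>i\<in>N. \<Sum>v\<in>V i. \<phi> i (j i) v * \<phi> i (j' i) v)"
      using N B' by (subst prod_sum_PiE) (auto simp: prod.distrib)
    also have "\<dots> = (\<Prod>i\<in>N. of_bool (j i = j' i))"
      using B'(4) j by (intro prod.cong refl) (auto dest!: PiE_mem)
    also have "\<dots> = of_bool (\<forall>i\<in>N. j i = j' i)" using N by (rule prod_of_bool)
    \<comment> \<open>Extensionality of the tuples in \<open>PiE\<close> makes agreement on
      \<open>N\<close> the same as equality.\<close>
    also have "(\<forall>i\<in>N. j i = j' i) \<longleftrightarrow> j = j'" using j by (auto intro: PiE_ext)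
    finally show "(\<Sum>x\<in>PiE N V. (\<Prod>i\<in>N. \<phi> i (j i) (x i)) * (\<Prod>i\<in>N. \<phi> i (j' i) (x i))) = of_bool (j = j')" .
  next
    fix x x' assume x: "x \<in> PiE N V" "x' \<in> PiE N V"
    have "(\<Sum>j\<in>PiE N I. (\<Prod>i\<in>N. \<phi> i (j i) (x i)) * (\<Prod>i\<in>N. \<phi> i (j i) (x' i)))
        = (\<Prod>i\<in>N. \<Sum>j\<in>I i. \<phi> i j (x i) * \<phi> i j (x' i))"
      using N B' by (subst prod_sum_PiE) (auto simp: prod.distrib)
    also have "\<dots> = (\<Prod>i\<in>N. of_bool (x i = x' i))"
      using B'(5) x by (intro prod.cong refl) (auto dest!: PiE_mem)
    also have "\<dots> = of_bool (\<forall>i\<in>N. x i = x' i)" using N by (rule prod_of_bool)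
    also have "(\<forall>i\<in>N. x i = x' i) \<longleftrightarrow> x = x'" using x by (auto intro: PiE_ext)
    finally show "(\<Sum>j\<in>PiE N I. (\<Prod>i\<in>N. \<phi> i (j i) (x i)) * (\<Prod>i\<in>N. \<phi> i (j i) (x' i))) = of_bool (x = x')" .
  qed
qed

section \<open>Gram matrices: nonzero eigenvalues and kernel\<close>

definition is_gram :: "'v set \<Rightarrow> ('v \<Rightarrow> 'v \<Rightarrow> real) \<Rightarrow> 'e set \<Rightarrow> ('v \<Rightarrow> 'e \<Rightarrow> real) \<Rightarrow> bool" where
  "is_gram V f E B \<longleftrightarrow> (\<forall>u\<in>V. \<forall>v\<in>V. f u v = (\<Sum>e\<in>E. B u e * B v e))"

lemma gram_apply:
  assumes "is_gram V f E B" "u \<in> V"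
  shows "(\<Sum>v\<in>V. f u v * x v) = (\<Sum>e\<in>E. B u e * (\<Sum>v\<in>V. B v e * x v))"
proof -
  have "(\<Sum>v\<in>V. f u v * x v) = (\<Sum>v\<in>V. \<Sum>e\<in>E. B u e * (B v e * x v))"
    using assms unfolding is_gram_def by (intro sum.cong refl) (simp add: sum_distrib_right mult.assoc)
  also have "\<dots> = (\<Sum>e\<in>E. \<Sum>v\<in>V. B u e * (B v e * x v))" by (rule sum.swap)
  finally show ?thesis by (simp add: sum_distrib_left)
qed

text \<open>Both sides are the scalar product of \<open>\<phi> i\<close> with its image under
  \<open>f = B B^T\<close>. Hence \<open>mu i \<ge> 0\<close>, and an eigenvector for 0 lies in the
  kernel of \<open>B^T\<close>.\<close>

lemma gram_norm:
  assumes B: "eigenbasis V f I mu \<phi>" and gram: "is_gram V f E B" and i: "i \<in> I"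
  shows "(\<Sum>e\<in>E. (\<Sum>v\<in>V. B v e * \<phi> i v)\<^sup>2) = mu i"
proof -
  note B' = eigenbasisD[OF B]
  have "(\<Sum>e\<in>E. (\<Sum>v\<in>V. B v e * \<phi> i v)\<^sup>2)
      = (\<Sum>e\<in>E. \<Sum>u\<in>V. \<phi> i u * (B u e * (\<Sum>v\<in>V. B v e * \<phi> i v)))"
    by (simp add: power2_eq_square sum_distrib_right mult_ac)
  also have "\<dots> = (\<Sum>u\<in>V. \<Sum>e\<in>E. \<phi> i u * (B u e * (\<Sum>v\<in>V. B v e * \<phi> i v)))"
    by (rule sum.swap)
  also have "\<dots> = (\<Sum>u\<in>V. \<phi> i u * (\<Sum>v\<in>V. f u v * \<phi> i v))"
    by (simp add: gram_apply[OF gram] flip: sum_distrib_left)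
  also have "\<dots> = (\<Sum>u\<in>V. mu i * (\<phi> i u * \<phi> i u))" using B'(3)[OF i] by (simp add: mult_ac)
  also have "\<dots> = mu i" using B'(4)[OF i i] by (simp flip: sum_distrib_left)
  finally show ?thesis .
qed

text \<open>With \<open>a i k\<close> the matrix coefficient of \<open>B\<close> between the two bases, \<open>a i k = 0\<close> unless
  \<open>mu i = nu k\<close>, and the squares in row \<open>i\<close> (column \<open>k\<close>) sum up to \<open>mu i\<close> (to \<open>nu k\<close>).
  Summing the squares over the block of the value \<open>x\<close> in both orders compares the
  multiplicities.\<close>

lemma gram_eigenvalue_count:
  assumes \<phi>: "eigenbasis V f I mu \<phi>" and gram1: "is_gram V f E B"
    and \<psi>: "eigenbasis E g K nu \<psi>" and gram2: "is_gram E g V (\<lambda>e v. B v e)"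
    and x: "x \<noteq> 0"
  shows "card {i\<in>I. mu i = x} = card {k\<in>K. nu k = x}"
proof -
  note P = eigenbasisD[OF \<phi>] and Q = eigenbasisD[OF \<psi>]
  define a where "a = (\<lambda>i k. \<Sum>e\<in>E. (\<Sum>v\<in>V. B v e * \<phi> i v) * \<psi> k e)"
  have a': "a i k = (\<Sum>v\<in>V. (\<Sum>e\<in>E. B v e * \<psi> k e) * \<phi> i v)" for i k
    unfolding a_def sum_distrib_right by (subst sum.swap) (simp add: mult_ac)
  have row: "(\<Sum>k\<in>K. (a i k)\<^sup>2) = mu i" if "i \<in> I" for i
    unfolding a_def using parseval[OF \<psi>] gram_norm[OF \<phi> gram1 that] by simp
  have col: "(\<Sum>i\<in>I. (a i k)\<^sup>2) = nu k" if "k \<in> K" for k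
    unfolding a' using parseval[OF \<phi>] gram_norm[OF \<psi> gram2 that] by simp
  \<comment> \<open>With \<open>T = B^T \<phi>\<close> and \<open>R = B \<psi>\<close>, moving
    \<open>B\<close> across the scalar product of \<open>R\<close> and \<open>B T\<close> gives
    \<open>mu i * a i k = nu k * a i k\<close>.\<close>
  have off: "a i k = 0" if "i \<in> I" "k \<in> K" "mu i \<noteq> nu k" for i k
  proof -
    define T where "T = (\<lambda>e. \<Sum>v\<in>V. B v e * \<phi> i v)"
    define R where "R = (\<lambda>v. \<Sum>e\<in>E. B v e * \<psi> k e)"
    have "mu i * a i k = (\<Sum>v\<in>V. R v * (mu i * \<phi> i v))"
      by (simp add: a' R_def sum_distrib_left mult_ac)
    also have "\<dots> = (\<Sum>v\<in>V. R v * (\<Sum>e\<in>E. B v e * T e))"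
      using P(3)[OF that(1)] by (simp add: gram_apply[OF gram1] T_def flip: P(3)[OF that(1)])
    also have "\<dots> = (\<Sum>e\<in>E. T e * (\<Sum>v\<in>V. B v e * R v))"
      unfolding sum_distrib_left by (subst sum.swap) (simp add: mult_ac)
    also have "\<dots> = (\<Sum>e\<in>E. T e * (nu k * \<psi> k e))"
      by (simp add: gram_apply[OF gram2] R_def flip: Q(3)[OF that(2)])
    also have "\<dots> = nu k * a i k" by (simp add: a_def T_def sum_distrib_left mult_ac)
    finally show ?thesis using that(3) by simp
  qed
  have "x * real (card {i\<in>I. mu i = x}) = (\<Sum>i\<in>{i\<in>I. mu i = x}. \<Sum>k\<in>K. (a i k)\<^sup>2)"
    using row by simp
  also have "\<dots> = (\<Sum>i\<in>{i\<in>I. mu i = x}. \<Sum>k\<in>{k\<in>K. nu k = x}. (a i k)\<^sup>2)"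
    using off Q(2) by (intro sum.cong[OF refl, OF sum.mono_neutral_right]) (auto, metis)
  also have "\<dots> = (\<Sum>k\<in>{k\<in>K. nu k = x}. \<Sum>i\<in>{i\<in>I. mu i = x}. (a i k)\<^sup>2)" by (rule sum.swap)
  also have "\<dots> = (\<Sum>k\<in>{k\<in>K. nu k = x}. \<Sum>i\<in>I. (a i k)\<^sup>2)"
    using off P(2) by (intro sum.cong[OF refl, OF sum.mono_neutral_left]) auto
  also have "\<dots> = x * real (card {k\<in>K. nu k = x})" using col by simp
  finally show ?thesis using x by simp
qed

text \<open>The squared inner products of the \<open>\<psi> c\<close> with the eigenvectors for 0
  are summed in both orders. For a fixed eigenvector \<open>complete\<close>, Parseval's identity on
  the kernel of \<open>B^T\<close>, gives 1. For a fixed \<open>c\<close> the other eigenvectors may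
  be added freely, being orthogonal to the kernel, and then \<open>parseval\<close> and
  \<open>norm\<close> give 1.\<close>

lemma gram_kernel_dimension:
  assumes \<phi>: "eigenbasis V f I mu \<phi>" and gram: "is_gram V f E B" and finE: "finite E"
    and norm: "\<And>c. c \<in> C \<Longrightarrow> (\<Sum>v\<in>V. (\<psi> c v)\<^sup>2) = 1"
    and ker: "\<And>c e. c \<in> C \<Longrightarrow> e \<in> E \<Longrightarrow> (\<Sum>v\<in>V. B v e * \<psi> c v) = 0"
    and complete: "\<And>x. (\<And>e. e \<in> E \<Longrightarrow> (\<Sum>v\<in>V. B v e * x v) = 0)
      \<Longrightarrow> (\<Sum>c\<in>C. (\<Sum>v\<in>V. x v * \<psi> c v)\<^sup>2) = (\<Sum>v\<in>V. (x v)\<^sup>2)"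
  shows "card {i\<in>I. mu i = 0} = card C"
proof -
  note P = eigenbasisD[OF \<phi>]
  have ker\<phi>: "(\<Sum>v\<in>V. B v e * \<phi> i v) = 0" if "i \<in> I" "mu i = 0" "e \<in> E" for i e
    using gram_norm[OF \<phi> gram that(1)] that finE by (simp add: sum_nonneg_eq_0_iff)
  \<comment> \<open>\<open>mu i\<close> times the scalar product of \<open>\<psi> c\<close> and
    \<open>\<phi> i\<close> is that of \<open>B^T (\<psi> c)\<close> and
    \<open>B^T (\<phi> i)\<close>, and the former vector is zero.\<close>
  have orth: "(\<Sum>v\<in>V. \<psi> c v * \<phi> i v) = 0" if "i \<in> I" "mu i \<noteq> 0" "c \<in> C" for i c
  proof -
    have "mu i * (\<Sum>v\<in>V. \<psi> c v * \<phi> i v)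
        = (\<Sum>v\<in>V. \<psi> c v * (\<Sum>e\<in>E. B v e * (\<Sum>w\<in>V. B w e * \<phi> i w)))"
      by (simp add: sum_distrib_left[of "mu i"] mult.left_commute[of "mu i"]
          flip: gram_apply[OF gram] P(3)[OF that(1)])
    also have "\<dots> = (\<Sum>e\<in>E. (\<Sum>w\<in>V. B w e * \<phi> i w) * (\<Sum>v\<in>V. B v e * \<psi> c v))"
      unfolding sum_distrib_left[of "\<psi> c _"] sum_distrib_left[of "\<Sum>w\<in>V. B w _ * \<phi> i w"]
      by (subst sum.swap) (simp add: mult_ac)
    also have "\<dots> = 0" using ker[OF that(3)] by simp
    finally show ?thesis using that(2) by simp
  qed
  have "real (card {i\<in>I. mu i = 0}) = (\<Sum>i\<in>{i\<in>I. mu i = 0}. \<Sum>v\<in>V. (\<phi> i v)\<^sup>2)"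
    using P(4) by (simp add: power2_eq_square)
  also have "\<dots> = (\<Sum>i\<in>{i\<in>I. mu i = 0}. \<Sum>c\<in>C. (\<Sum>v\<in>V. \<psi> c v * \<phi> i v)\<^sup>2)"
    using ker\<phi> by (intro sum.cong refl) (subst complete[symmetric], auto simp: mult.commute)
  also have "\<dots> = (\<Sum>c\<in>C. \<Sum>i\<in>{i\<in>I. mu i = 0}. (\<Sum>v\<in>V. \<psi> c v * \<phi> i v)\<^sup>2)" by (rule sum.swap)
  also have "\<dots> = (\<Sum>c\<in>C. \<Sum>i\<in>I. (\<Sum>v\<in>V. \<psi> c v * \<phi> i v)\<^sup>2)"
    using orth P(2) by (intro sum.cong[OF refl, OF sum.mono_neutral_left]) auto
  also have "\<dots> = real (card C)" using parseval[OF \<phi>] norm by simp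
  finally show ?thesis by simp
qed

section \<open>Balance and switching\<close>

definition is_walk :: "'v sgraph \<Rightarrow> 'v list \<Rightarrow> bool" where
  "is_walk S w \<longleftrightarrow> w \<noteq> [] \<and> successively (\<lambda>u v. {u, v} \<in> sg_edges S) w"

fun walk_sign :: "'v sgraph \<Rightarrow> 'v list \<Rightarrow> real" where
  "walk_sign S [] = 1"
| "walk_sign S [x] = 1"
| "walk_sign S (x # y # w) = sg_sign S {x, y} * walk_sign S (y # w)"

lemma is_walk_append:
  "a \<noteq> [] \<Longrightarrow> b \<noteq> [] \<Longrightarrow>
    is_walk S (a @ b) \<longleftrightarrow> is_walk S a \<and> is_walk S b \<and> {last a, hd b} \<in> sg_edges S"
  by (auto simp: is_walk_def successively_append_iff)

lemma is_walk_rev: "is_walk S (rev w) \<longleftrightarrow> is_walk S w"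
  by (simp add: is_walk_def insert_commute)

lemma walk_sign_append:
  "a \<noteq> [] \<Longrightarrow> b \<noteq> [] \<Longrightarrow>
    walk_sign S (a @ b) = walk_sign S a * sg_sign S {last a, hd b} * walk_sign S b"
proof (induction a rule: induct_list012)
  case (2 x)
  then show ?case by (cases b) auto
qed auto

text \<open>The vertex \<open>y\<close> belongs to both pieces, so no edge is lost at the
  joint.\<close>

lemma walk_sign_split: "walk_sign S (a @ y # b) = walk_sign S (a @ [y]) * walk_sign S (y # b)"
proof (cases "a = []")
  case False
  then show ?thesis
    using walk_sign_append[of a "y # b" S] walk_sign_append[of a "[y]" S] by simp
qed simp

lemma walk_sign_rev: "walk_sign S (rev w) = walk_sign S w"
proof (induction w rule: induct_list012)
  case (3 x y zs)
  have "walk_sign S (rev (y # zs) @ [x]) = walk_sign S (rev (y # zs)) * sg_sign S {y, x}"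
    by (subst walk_sign_append) auto
  then show ?case using 3 by (simp add: insert_commute)
qed auto

lemma walk_sign_cases:
  assumes "signed_graph S"
  shows "is_walk S w \<Longrightarrow> walk_sign S w \<in> {1, -1}"
proof (induction w rule: induct_list012)
  case (3 x y zs)
  then have "walk_sign S (y # zs) \<in> {1, -1}" "sg_sign S {x, y} \<in> {1, -1}"
    using signed_graphD(5)[OF assms] by (auto simp: is_walk_def)
  then show ?case by auto
qed auto

text \<open>The edge relation telescopes. On a closed walk of sign other than 1 it forces
  \<open>x\<close> to vanish at the start.\<close>

lemma walk_transfer:
  assumes "\<And>u v. {u, v} \<in> sg_edges S \<Longrightarrow> x u = sg_sign S {u, v} * x v"
  shows "is_walk S w \<Longrightarrow> x (hd w) = walk_sign S w * x (last w)"
proof (induction w rule: induct_list012)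
  case (3 u v w)
  have "x u = sg_sign S {u, v} * x v" using "3.prems" by (intro assms) (simp add: is_walk_def)
  moreover have "x v = walk_sign S (v # w) * x (last (v # w))"
    using "3.prems" "3.IH"(2) by (simp add: is_walk_def)
  ultimately show ?case by (simp only: walk_sign.simps list.sel last_ConsR[of "v # w"] list.distinct mult.assoc not_False_eq_True)
qed (auto simp: is_walk_def)

lemma walk_exists:
  assumes "(u, v) \<in> {(x, y). {x, y} \<in> sg_edges S}\<^sup>*"
  obtains w where "is_walk S w" "hd w = u" "last w = v"
proof -
  have "\<exists>w. is_walk S w \<and> hd w = u \<and> last w = v"
    using assms
  proof (induction rule: rtrancl_induct)
    case base
    show ?case by (intro exI[of _ "[u]"]) (simp add: is_walk_def)
  next
    case (step y z)
    then obtain w where "is_walk S w" "hd w = u" "last w = y" by blast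
    moreover from this have "w \<noteq> []" by (simp add: is_walk_def)
    ultimately show ?case using step(2)
      by (intro exI[of _ "w @ [z]"]) (simp add: is_walk_append, simp add: is_walk_def)
  qed
  then show thesis using that by blast
qed

lemma walk_sign_conv_prod: "walk_sign S w = (\<Prod>i<length w - 1. sg_sign S {w ! i, w ! Suc i})"
proof (induction w rule: induct_list012)
  case (3 x y zs)
  then show ?case by (simp add: prod.lessThan_Suc_shift del: prod.lessThan_Suc)
qed auto

lemma is_walk_conv_nth:
  "is_walk S w \<longleftrightarrow> w \<noteq> [] \<and> (\<forall>i<length w - 1. {w ! i, w ! Suc i} \<in> sg_edges S)"
proof (induction w rule: induct_list012)
  case (3 x y zs)
  then show ?case by (auto simp: is_walk_def less_Suc_eq_0_disj)
qed (auto simp: is_walk_def)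

text \<open>Appending the first vertex unrolls the cyclic index of \<open>cycle_edge\<close>, so
  that a cycle becomes a closed walk.\<close>

lemma closed_walk_nth:
  assumes "i < length vs"
  shows "{(vs @ [hd vs]) ! i, (vs @ [hd vs]) ! Suc i} = cycle_edge vs i"
proof (cases "Suc i = length vs")
  case True
  moreover from assms have "hd vs = vs ! 0" by (intro hd_conv_nth) auto
  ultimately show ?thesis using assms by (simp add: cycle_edge_def nth_append)
next
  case False
  then show ?thesis using assms by (simp add: cycle_edge_def nth_append)
qed

lemma is_cycle_iff_walk:
  "is_cycle S vs \<longleftrightarrow> length vs \<ge> 3 \<and> distinct vs \<and> is_walk S (vs @ [hd vs])"
  by (auto simp: is_cycle_def is_walk_conv_nth closed_walk_nth simp del: nth_append_length)

lemma cycle_sign_conv_walk_sign: "cycle_sign S vs = walk_sign S (vs @ [hd vs])"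
  by (simp add: cycle_sign_def walk_sign_conv_prod closed_walk_nth)

text \<open>Balance only concerns cycles. A closed walk that repeats a vertex before its end splits
  into two shorter closed walks. Otherwise it is a single vertex, an edge traversed back and forth,
  whose sign squares to 1, or a cycle; one step from a vertex to itself would be a loop.\<close>

lemma balanced_closed_walk:
  assumes S: "signed_graph S" and bal: "balanced S"
  shows "is_walk S w \<Longrightarrow> hd w = last w \<Longrightarrow> walk_sign S w = 1"
proof (induction w rule: length_induct)
  case (1 w)
  have loop: "x \<noteq> y" if "{x, y} \<in> sg_edges S" for x y
    using signed_graphD(4)[OF S that] by auto
  from "1.prems" obtain vs x where w: "w = vs @ [x]"
    by (metis is_walk_def append_butlast_last_id)
  show ?case
  proof (cases "vs = []")
    case False
    then have x: "x = hd vs" using "1.prems"(2) w by simp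
    show ?thesis
    proof (cases "distinct vs")
      case True
      consider y where "vs = [y]" | y z where "vs = [y, z]" | "length vs \<ge> 3"
        using False by (cases vs; cases "tl vs"; cases "tl (tl vs)") auto
      then show ?thesis
      proof cases
        case 1
        then have "{x, x} \<in> sg_edges S" using "1.prems"(1) w x by (simp add: is_walk_def)
        then show ?thesis using loop by blast
      next
        case (2 y z)
        then have "sg_sign S {y, z} \<in> {1, -1}"
          using "1.prems"(1) w x signed_graphD(5)[OF S] by (simp add: is_walk_def)
        then show ?thesis using 2 w x by (auto simp: insert_commute)
      next
        case 3
        then have "is_cycle S vs" using True "1.prems"(1) w x by (simp add: is_cycle_iff_walk)
        then show ?thesis using bal w x by (simp add: balanced_def cycle_sign_conv_walk_sign)
      qed
    next
      case False
      \<comment> \<open>The segment between two occurrences of \<open>y\<close> becomes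
        \<open>?w1\<close>; excising it leaves \<open>?w2\<close>.\<close>
      then obtain a b c y where vs: "vs = a @ [y] @ b @ [y] @ c"
        using not_distinct_decomp by blast
      let ?w1 = "y # b @ [y]" and ?w2 = "a @ y # c @ [x]"
      have w12: "w = a @ y # b @ y # c @ [x]" using w vs by simp
      have "is_walk S ?w1" "is_walk S ?w2"
        using "1.prems"(1) unfolding w12 is_walk_def
        by (auto simp: successively_append_iff successively_Cons hd_append split: if_splits)
      moreover have "hd ?w2 = last ?w2" using "1.prems"(2) unfolding w12 by (cases a) auto
      moreover have "length ?w1 < length w" "length ?w2 < length w" using w12 by auto
      ultimately have "walk_sign S ?w1 = 1" "walk_sign S ?w2 = 1" using "1.IH" by auto
      moreover have "walk_sign S w = walk_sign S (a @ [y]) * walk_sign S ?w1 * walk_sign S (y # c @ [x])"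
        unfolding w12 using walk_sign_split[of S a y "b @ y # c @ [x]"]
          walk_sign_split[of S "y # b" y "c @ [x]"] by simp
      ultimately show ?thesis using walk_sign_split[of S a y "c @ [x]"] by simp
    qed
  qed (simp add: w)
qed

text \<open>\<open>s v\<close> is the sign of a chosen walk from \<open>r\<close> to
  \<open>v\<close>. The choice is harmless because closed walks are positive.\<close>

lemma balanced_connected_switching:
  assumes S: "signed_graph S" and bal: "balanced S"
    and conn: "\<And>v. v \<in> sg_verts S \<Longrightarrow> (r, v) \<in> {(x, y). {x, y} \<in> sg_edges S}\<^sup>*"
  obtains s :: "'v \<Rightarrow> real" where "\<And>v. v \<in> sg_verts S \<Longrightarrow> s v \<in> {1, -1}"
    and "\<And>u v. {u, v} \<in> sg_edges S \<Longrightarrow> s u = sg_sign S {u, v} * s v"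
proof -
  define W where "W = (\<lambda>v. SOME w. is_walk S w \<and> hd w = r \<and> last w = v)"
  have W: "is_walk S (W v)" "hd (W v) = r" "last (W v) = v" if v: "v \<in> sg_verts S" for v
  proof -
    have "\<exists>w. is_walk S w \<and> hd w = r \<and> last w = v" using conn[OF v] walk_exists by metis
    then have "is_walk S (W v) \<and> hd (W v) = r \<and> last (W v) = v" unfolding W_def by (rule someI_ex)
    then show "is_walk S (W v)" "hd (W v) = r" "last (W v) = v" by blast+
  qed
  show thesis
  proof (rule that[of "\<lambda>v. walk_sign S (W v)"])
    show pm: "walk_sign S (W v) \<in> {1, -1}" if "v \<in> sg_verts S" for v
      using walk_sign_cases[OF S W(1)[OF that]] .
    fix u v assume e: "{u, v} \<in> sg_edges S"
    then have uv: "u \<in> sg_verts S" "v \<in> sg_verts S" using signed_graphD(3)[OF S e] by auto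
    have ne: "W u \<noteq> []" "W v \<noteq> []" using W(1) uv by (auto simp: is_walk_def)
    \<comment> \<open>From \<open>r\<close> to \<open>u\<close>, along the edge to \<open>v\<close>,
      and back to \<open>r\<close> on the reversed walk.\<close>
    let ?w = "W u @ rev (W v)"
    have "is_walk S ?w" using W uv ne e by (simp add: is_walk_append is_walk_rev hd_rev)
    moreover have "hd ?w = last ?w" using W uv ne by (simp add: last_rev)
    ultimately have "walk_sign S ?w = 1" by (rule balanced_closed_walk[OF S bal])
    then have "walk_sign S (W u) * sg_sign S {u, v} * walk_sign S (W v) = 1"
      using W uv ne by (simp add: walk_sign_append walk_sign_rev hd_rev)
    then show "walk_sign S (W u) = sg_sign S {u, v} * walk_sign S (W v)"
      using pm[OF uv(1)] pm[OF uv(2)] signed_graphD(5)[OF S e] by auto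
  qed
qed

section \<open>Components and switching functions\<close>

lemma equiv_connected_in: "equiv (sg_verts S) (connected_in S)"
proof (rule equivI)
  have "sym ({(x, y). {x, y} \<in> sg_edges S}\<^sup>*)"
    by (intro sym_rtrancl symI) (auto simp: insert_commute)
  then show "sym (connected_in S)" by (auto simp: connected_in_def sym_def)
qed (auto simp: connected_in_def refl_on_def intro!: transI)

lemma Union_components: "\<Union> (sg_components S) = sg_verts S"
  unfolding sg_components_def by (rule Union_quotient[OF equiv_connected_in])

lemma component_subset: "C \<in> sg_components S \<Longrightarrow> C \<subseteq> sg_verts S"
  by (metis Union_components Union_upper)

lemma component_nonempty: "C \<in> sg_components S \<Longrightarrow> C \<noteq> {}"
  using in_quotient_imp_non_empty[OF equiv_connected_in] unfolding sg_components_def by blast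

lemma component_edge_closed:
  assumes S: "signed_graph S" and C: "C \<in> sg_components S"
    and e: "{u, v} \<in> sg_edges S" and u: "u \<in> C"
  shows "v \<in> C"
proof -
  have "(u, v) \<in> connected_in S"
    using e signed_graphD(3)[OF S e] by (auto simp: connected_in_def)
  then show ?thesis
    using in_quotient_imp_closed[OF equiv_connected_in C[unfolded sg_components_def] u] by blast
qed

text \<open>A component is closed under edges, so a path that starts in \<open>C\<close> never
  leaves it.\<close>

lemma component_connected:
  assumes S: "signed_graph S" and C: "C \<in> sg_components S" and u: "u \<in> C" and v: "v \<in> C"
  shows "(u, v) \<in> {(x, y). {x, y} \<in> sg_edges (induced_sgraph S C)}\<^sup>*"
proof -
  have "(u, v) \<in> connected_in S"
    using quotient_eq_iff[OF equiv_connected_in C[unfolded sg_components_def] C[unfolded sg_components_def] u v]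
    by blast
  then have "(u, v) \<in> {(x, y). {x, y} \<in> sg_edges S}\<^sup>*" by (simp add: connected_in_def)
  then have "v \<in> C \<and> (u, v) \<in> {(x, y). {x, y} \<in> sg_edges (induced_sgraph S C)}\<^sup>*"
  proof (induction rule: rtrancl_induct)
    case base
    show ?case using u by simp
  next
    case (step y z)
    then have "z \<in> C" using component_edge_closed[OF S C] by blast
    then have "(y, z) \<in> {(x, y). {x, y} \<in> sg_edges (induced_sgraph S C)}"
      using step by (simp add: induced_sgraph_def)
    then show ?case using step \<open>z \<in> C\<close> by (meson rtrancl.rtrancl_into_rtrancl)
  qed
  then show ?thesis by simp
qed

lemma signed_graph_induced:
  "signed_graph S \<Longrightarrow> C \<subseteq> sg_verts S \<Longrightarrow> signed_graph (induced_sgraph S C)"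
  unfolding signed_graph_def induced_sgraph_def by (auto intro: finite_subset)

lemma component_constant:
  assumes S: "signed_graph S" and C: "C \<in> sg_components S" and uv: "u \<in> C" "v \<in> C"
    and y: "\<And>u v. {u, v} \<in> sg_edges (induced_sgraph S C) \<Longrightarrow> y u = y v"
  shows "y u = y v"
  using component_connected[OF S C uv] by (induction rule: rtrancl_induct) (auto dest: y)

text \<open>Going once around a cycle of sign other than 1 shows that \<open>x\<close> is zero at
  one of its vertices. As signs have modulus 1, the absolute value of \<open>x\<close> is constant
  on the component.\<close>

lemma unbalanced_component_vanishing:
  fixes x :: "'v \<Rightarrow> real"
  assumes S: "signed_graph S" and C: "C \<in> sg_components S"
    and unbal: "\<not> balanced (induced_sgraph S C)"
    and x: "\<And>u v. {u, v} \<in> sg_edges S \<Longrightarrow> x u = sg_sign S {u, v} * x v" and v: "v \<in> C"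
  shows "x v = 0"
proof -
  let ?T = "induced_sgraph S C"
  have T: "sg_sign ?T = sg_sign S" "sg_edges ?T \<subseteq> sg_edges S" by (auto simp: induced_sgraph_def)
  obtain vs where vs: "is_cycle ?T vs" "cycle_sign ?T vs \<noteq> 1"
    using unbal by (auto simp: balanced_def)
  then have "x (hd (vs @ [hd vs])) = walk_sign ?T (vs @ [hd vs]) * x (last (vs @ [hd vs]))"
    using T by (intro walk_transfer) (auto simp: is_cycle_iff_walk intro!: x)
  moreover have ne: "vs \<noteq> []" using vs by (auto simp: is_cycle_def)
  ultimately have "x (hd vs) = cycle_sign ?T vs * x (hd vs)"
    by (simp add: cycle_sign_conv_walk_sign)
  then have "x (hd vs) = 0" using vs(2) by simp
  moreover have "hd vs \<in> C"
  proof -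
    have "cycle_edge vs 0 \<in> sg_edges ?T" using vs(1) ne by (auto simp: is_cycle_def)
    then show ?thesis using ne by (simp add: cycle_edge_def induced_sgraph_def hd_conv_nth)
  qed
  moreover have "\<bar>x v\<bar> = \<bar>x (hd vs)\<bar>"
  proof (rule component_constant[OF S C v \<open>hd vs \<in> C\<close>])
    fix u w assume "{u, w} \<in> sg_edges ?T"
    then have "{u, w} \<in> sg_edges S" using T by blast
    then show "\<bar>x u\<bar> = \<bar>x w\<bar>" using x signed_graphD(5)[OF S] by (fastforce simp: abs_mult)
  qed
  ultimately show ?thesis by simp
qed

text \<open>The edge relation carries over from the induced graph to \<open>S\<close>, because every
  edge with one end in \<open>C\<close> lies in \<open>C\<close>.\<close>

lemma balanced_component_switching:
  assumes S: "signed_graph S" and C: "C \<in> sg_components S"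
    and bal: "balanced (induced_sgraph S C)"
  shows "\<exists>s :: 'v \<Rightarrow> real. (\<forall>v\<in>C. s v \<in> {1, -1})
    \<and> (\<forall>u v. {u, v} \<in> sg_edges S \<longrightarrow> u \<in> C \<longrightarrow> s u = sg_sign S {u, v} * s v)"
proof -
  let ?T = "induced_sgraph S C"
  obtain r where r: "r \<in> C" using component_nonempty[OF C] by blast
  obtain s where s: "\<And>v. v \<in> sg_verts ?T \<Longrightarrow> s v \<in> {1, -1 :: real}"
      "\<And>u v. {u, v} \<in> sg_edges ?T \<Longrightarrow> s u = sg_sign ?T {u, v} * s v"
  proof (rule balanced_connected_switching[OF signed_graph_induced[OF S component_subset[OF C]] bal])
    fix v assume "v \<in> sg_verts ?T"
    then show "(r, v) \<in> {(x, y). {x, y} \<in> sg_edges ?T}\<^sup>*"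
      by (intro component_connected[OF S C r]) (simp add: induced_sgraph_def)
  qed blast
  have "s u = sg_sign S {u, v} * s v" if "{u, v} \<in> sg_edges S" "u \<in> C" for u v
    using s(2)[of u v] component_edge_closed[OF S C that] that by (simp add: induced_sgraph_def)
  then show ?thesis using s(1) by (intro exI[of _ s]) (auto simp: induced_sgraph_def)
qed

section \<open>The incidence matrix, its kernel and its Gram matrix\<close>

lemma incidence_matrixD:
  assumes "incidence_matrix S H"
  shows "v \<in> sg_verts S \<Longrightarrow> e \<in> sg_edges S \<Longrightarrow> v \<notin> e \<Longrightarrow> H v e = 0"
    and "v \<in> sg_verts S \<Longrightarrow> e \<in> sg_edges S \<Longrightarrow> v \<in> e \<Longrightarrow> H v e \<in> {1, -1}"
    and "u \<in> sg_verts S \<Longrightarrow> v \<in> sg_verts S \<Longrightarrow> {u, v} \<in> sg_edges S \<Longrightarrow>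
      H u {u, v} * H v {u, v} = - sg_sign S {u, v}"
  using assms unfolding incidence_matrix_def by metis+

text \<open>The column of an edge has just two nonzero entries; they are \<open>1\<close> or
  \<open>-1\<close>, with product minus the sign of the edge.\<close>

lemma incidence_kernel_edge:
  assumes S: "signed_graph S" and H: "incidence_matrix S H" and e: "{u, v} \<in> sg_edges S"
  shows "(\<Sum>w\<in>sg_verts S. H w {u, v} * x w) = 0 \<longleftrightarrow> x u = sg_sign S {u, v} * x v"
proof -
  have uv: "u \<in> sg_verts S" "v \<in> sg_verts S" "u \<noteq> v"
    using signed_graphD(3,4)[OF S e] by auto
  have "(\<Sum>w\<in>sg_verts S. H w {u, v} * x w) = (\<Sum>w\<in>{u, v}. H w {u, v} * x w)"
    using uv signed_graphD(1)[OF S] incidence_matrixD(1)[OF H _ e] by (intro sum.mono_neutral_right) auto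
  also have "\<dots> = H u {u, v} * x u + H v {u, v} * x v" using uv by simp
  finally show ?thesis
    using incidence_matrixD(2)[OF H uv(1) e] incidence_matrixD(2)[OF H uv(2) e]
      incidence_matrixD(3)[OF H uv(1,2) e] by auto
qed

lemma incidence_kernel_iff:
  assumes S: "signed_graph S" and H: "incidence_matrix S H"
  shows "(\<forall>e\<in>sg_edges S. (\<Sum>w\<in>sg_verts S. H w e * x w) = 0)
    \<longleftrightarrow> (\<forall>u v. {u, v} \<in> sg_edges S \<longrightarrow> x u = sg_sign S {u, v} * x v)"
proof
  assume "\<forall>e\<in>sg_edges S. (\<Sum>w\<in>sg_verts S. H w e * x w) = 0"
  then show "\<forall>u v. {u, v} \<in> sg_edges S \<longrightarrow> x u = sg_sign S {u, v} * x v"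
    using incidence_kernel_edge[OF S H] by blast
next
  assume x: "\<forall>u v. {u, v} \<in> sg_edges S \<longrightarrow> x u = sg_sign S {u, v} * x v"
  show "\<forall>e\<in>sg_edges S. (\<Sum>w\<in>sg_verts S. H w e * x w) = 0"
  proof
    fix e assume e: "e \<in> sg_edges S"
    then obtain u v where "e = {u, v}" using signed_graphD(4)[OF S e] by (meson card_2_iff)
    then show "(\<Sum>w\<in>sg_verts S. H w e * x w) = 0"
      using incidence_kernel_edge[OF S H, of u v x] e x by blast
  qed
qed

lemma adj_entry_same: "signed_graph S \<Longrightarrow> adj_entry S u u = 0"
  using signed_graphD(4)[of S "{u}"] by (auto simp: adj_entry_def)

text \<open>On the diagonal every edge at \<open>u\<close> contributes 1, giving the degree
  \<open>k\<close>. Off the diagonal only the edge \<open>{u, v}\<close> itself can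
  contribute.\<close>

lemma incidence_is_gram:
  assumes S: "signed_graph S" and H: "incidence_matrix S H" and reg: "regular_sgraph S k"
  shows "is_gram (sg_verts S) (\<lambda>u v. real k * of_bool (u = v) - adj_entry S u v) (sg_edges S) H"
  unfolding is_gram_def
proof (intro ballI)
  fix u v assume u: "u \<in> sg_verts S" and v: "v \<in> sg_verts S"
  note fin = signed_graphD(2)[OF S]
  show "real k * of_bool (u = v) - adj_entry S u v = (\<Sum>e\<in>sg_edges S. H u e * H v e)"
  proof (cases "u = v")
    case True
    have "(\<Sum>e\<in>sg_edges S. H u e * H u e) = (\<Sum>e\<in>sg_edges S. of_bool (u \<in> e))"
      using incidence_matrixD(1,2)[OF H u] by (intro sum.cong refl) fastforce
    also have "\<dots> = real (card {e\<in>sg_edges S. u \<in> e})"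
      using fin by (simp add: sum_of_bool_eq Int_def)
    finally show ?thesis using True u S reg
      by (simp add: adj_entry_same regular_sgraph_def degree_in_def)
  next
    case False
    have "H u e * H v e = 0" if "e \<in> sg_edges S" "e \<noteq> {u, v}" for e
    proof (rule ccontr)
      assume "H u e * H v e \<noteq> 0"
      then have "{u, v} \<subseteq> e" using incidence_matrixD(1)[OF H] u v that by fastforce
      moreover have "card {u, v} = card e" using False signed_graphD(4)[OF S that(1)] by simp
      ultimately have "{u, v} = e"
        using signed_graphD(4)[OF S that(1)] by (intro card_subset_eq) (auto intro: card_ge_0_finite)
      then show False using that by simp
    qed
    then have "(\<Sum>e\<in>sg_edges S. H u e * H v e)
        = (\<Sum>e\<in>sg_edges S. if e = {u, v} then H u {u, v} * H v {u, v} else 0)"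
      by (intro sum.cong refl) auto
    then show ?thesis using False fin incidence_matrixD(3)[OF H u v] by (simp add: adj_entry_def)
  qed
qed

text \<open>The eigenvectors for the eigenvalue \<open>k\<close> are the kernel of the transposed incidence matrix.
  The normalized switching functions of the balanced components are an orthonormal basis of
  it.\<close>

lemma card_eigenvalue_eq_degree:
  fixes S :: "'v sgraph"
  assumes S: "signed_graph S" and reg: "regular_sgraph S k"
    and B: "eigenbasis (sg_verts S) (adj_entry S) I lam \<phi>"
  shows "card {i\<in>I. lam i = real k} = num_balanced S"
proof -
  obtain H where H: "incidence_matrix S H" using incidence_matrix_exists[OF S] by blast
  define V where "V = sg_verts S"
  define Cs where "Cs = {C \<in> sg_components S. balanced (induced_sgraph S C)}"
  have finV: "finite V" using signed_graphD(1)[OF S] V_def by simp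
  have CV: "C \<subseteq> V" if "C \<in> sg_components S" for C using component_subset that V_def by blast
  have finC: "finite C" if "C \<in> sg_components S" for C using CV[OF that] finV finite_subset by blast
  have "\<forall>C\<in>Cs. \<exists>s :: 'v \<Rightarrow> real. (\<forall>v\<in>C. s v \<in> {1, -1})
      \<and> (\<forall>u v. {u, v} \<in> sg_edges S \<longrightarrow> u \<in> C \<longrightarrow> s u = sg_sign S {u, v} * s v)"
    using balanced_component_switching[OF S] by (auto simp: Cs_def)
  then obtain s :: "'v set \<Rightarrow> 'v \<Rightarrow> real" where s: "\<And>C v. C \<in> Cs \<Longrightarrow> v \<in> C \<Longrightarrow> s C v \<in> {1, -1}"
    and s_edge: "\<And>C u v. C \<in> Cs \<Longrightarrow> {u, v} \<in> sg_edges S \<Longrightarrow> u \<in> C \<Longrightarrow> s C u = sg_sign S {u, v} * s C v"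
    by (metis (no_types, lifting) bchoice)
  have s_sq: "s C v * s C v = 1" if "C \<in> Cs" "v \<in> C" for C v using s[OF that] by auto
  \<comment> \<open>A switching function has modulus 1 on \<open>C\<close>, whence the normalizing
    factor.\<close>
  define \<psi> where "\<psi> = (\<lambda>C v. if v \<in> C then s C v / sqrt (real (card C)) else 0)"
  have cpos: "card C > 0" if "C \<in> Cs" for C
    using that component_nonempty finC by (auto simp: Cs_def card_gt_0_iff)
  have sum_\<psi>: "(\<Sum>v\<in>V. x v * \<psi> C v) = (\<Sum>v\<in>C. x v * s C v) / sqrt (real (card C))"
    if "C \<in> Cs" for C x
  proof -
    have C: "C \<in> sg_components S" using that by (simp add: Cs_def)
    have "(\<Sum>v\<in>V. x v * \<psi> C v) = (\<Sum>v\<in>C. x v * \<psi> C v)"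
      using finV CV[OF C] by (intro sum.mono_neutral_right) (auto simp: \<psi>_def)
    then show ?thesis by (simp add: \<psi>_def sum_divide_distrib)
  qed
  have "card {i\<in>I. real k + (-1) * lam i = 0} = card Cs"
  proof (rule gram_kernel_dimension[where \<psi> = \<psi>])
    show "eigenbasis V (\<lambda>u v. real k * of_bool (u = v) - adj_entry S u v) I
        (\<lambda>i. real k + (-1) * lam i) \<phi>"
      by (rule eigenbasis_affine[OF B[folded V_def]]) simp
    show "is_gram V (\<lambda>u v. real k * of_bool (u = v) - adj_entry S u v) (sg_edges S) H"
      unfolding V_def by (rule incidence_is_gram[OF S H reg])
    show "finite (sg_edges S)" by (rule signed_graphD(2)[OF S])
  next
    fix C assume C: "C \<in> Cs"
    have "(\<Sum>v\<in>V. (\<psi> C v)\<^sup>2) = (\<Sum>v\<in>C. \<psi> C v * s C v) / sqrt (real (card C))"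
      unfolding power2_eq_square by (rule sum_\<psi>[OF C])
    also have "(\<Sum>v\<in>C. \<psi> C v * s C v) = (\<Sum>v\<in>C. 1 / sqrt (real (card C)))"
      using s_sq[OF C] by (intro sum.cong refl) (simp add: \<psi>_def)
    finally show "(\<Sum>v\<in>V. (\<psi> C v)\<^sup>2) = 1" using cpos[OF C] by simp
  next
    fix C e assume C: "C \<in> Cs" and e: "e \<in> sg_edges S"
    have C': "C \<in> sg_components S" using C by (simp add: Cs_def)
    have "\<psi> C u = sg_sign S {u, v} * \<psi> C v" if uv: "{u, v} \<in> sg_edges S" for u v
    proof -
      have "u \<in> C \<longleftrightarrow> v \<in> C"
        using component_edge_closed[OF S C'] uv by (metis insert_commute)
      then show ?thesis using s_edge[OF C uv] by (simp add: \<psi>_def)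
    qed
    then show "(\<Sum>v\<in>V. H v e * \<psi> C v) = 0"
      using incidence_kernel_iff[OF S H, of "\<psi> C"] e unfolding V_def by blast
  next
    fix x assume "\<And>e. e \<in> sg_edges S \<Longrightarrow> (\<Sum>v\<in>V. H v e * x v) = 0"
    then have x: "x u = sg_sign S {u, v} * x v" if "{u, v} \<in> sg_edges S" for u v
      using that incidence_kernel_iff[OF S H, of x] unfolding V_def by blast
    \<comment> \<open>The squared norm splits over the components, and the unbalanced ones
      contribute nothing.\<close>
    have "(\<Sum>v\<in>V. (x v)\<^sup>2) = (\<Sum>C\<in>sg_components S. \<Sum>v\<in>C. (x v)\<^sup>2)"
    proof -
      have "\<forall>C\<in>sg_components S. \<forall>D\<in>sg_components S. C \<noteq> D \<longrightarrow> C \<inter> D = {}"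
        using quotient_disj[OF equiv_connected_in] unfolding sg_components_def by metis
      then show ?thesis
        using sum.Union_disjoint[of "sg_components S" "\<lambda>v. (x v)\<^sup>2"] finC
        by (simp add: V_def Union_components)
    qed
    also have "\<dots> = (\<Sum>C\<in>Cs. \<Sum>v\<in>C. (x v)\<^sup>2)"
    proof (rule sum.mono_neutral_right)
      show "finite (sg_components S)"
        by (rule finite_UnionD) (use finV in \<open>simp add: V_def Union_components\<close>)
      show "\<forall>C\<in>sg_components S - Cs. (\<Sum>v\<in>C. (x v)\<^sup>2) = 0"
      proof (intro ballI sum.neutral)
        fix C v assume "C \<in> sg_components S - Cs" "v \<in> C"
        then have "x v = 0"
          by (intro unbalanced_component_vanishing[OF S _ _ x, where C = C]) (auto simp: Cs_def)
        then show "(x v)\<^sup>2 = 0" by simp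
      qed
    qed (simp add: Cs_def)
    also have "\<dots> = (\<Sum>C\<in>Cs. (\<Sum>v\<in>V. x v * \<psi> C v)\<^sup>2)"
    proof (rule sum.cong[OF refl])
      fix C assume C: "C \<in> Cs"
      have C': "C \<in> sg_components S" using C by (simp add: Cs_def)
      obtain r where r: "r \<in> C" using component_nonempty[OF C'] by blast
      \<comment> \<open>Along an edge both \<open>x\<close> and \<open>s C\<close> change by its
        sign, so their product stays constant: on \<open>C\<close>, \<open>x\<close> is
        \<open>c\<close> times the switching function.\<close>
      define c where "c = x r * s C r"
      have xs: "x v * s C v = c" if v: "v \<in> C" for v
        unfolding c_def
      proof (rule component_constant[OF S C' v r, of "\<lambda>v. x v * s C v"])
        fix u v assume "{u, v} \<in> sg_edges (induced_sgraph S C)"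
        then have e: "{u, v} \<in> sg_edges S" "u \<in> C" by (auto simp: induced_sgraph_def)
        have "sg_sign S {u, v} * sg_sign S {u, v} = 1" using signed_graphD(5)[OF S e(1)] by auto
        moreover have "x u * s C u = (sg_sign S {u, v} * sg_sign S {u, v}) * (x v * s C v)"
          unfolding x[OF e(1)] s_edge[OF C e] by (simp only: mult_ac)
        ultimately show "x u * s C u = x v * s C v" by simp
      qed
      have "(x v)\<^sup>2 = c\<^sup>2" if v: "v \<in> C" for v
      proof -
        have "c\<^sup>2 = (x v)\<^sup>2 * (s C v * s C v)"
          unfolding xs[OF v, symmetric] by (simp add: power2_eq_square mult_ac)
        then show ?thesis using s_sq[OF C v] by simp
      qed
      moreover have "(\<Sum>v\<in>V. x v * \<psi> C v) = real (card C) * c / sqrt (real (card C))"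
        unfolding sum_\<psi>[OF C] using xs by simp
      ultimately show "(\<Sum>v\<in>C. (x v)\<^sup>2) = (\<Sum>v\<in>V. x v * \<psi> C v)\<^sup>2"
        using cpos[OF C] by (simp add: power_divide power_mult_distrib power2_eq_square)
    qed
    finally show "(\<Sum>C\<in>Cs. (\<Sum>v\<in>V. x v * \<psi> C v)\<^sup>2) = (\<Sum>v\<in>V. (x v)\<^sup>2)" by simp
  qed
  moreover have "{i\<in>I. real k + (-1) * lam i = 0} = {i\<in>I. lam i = real k}" by auto
  ultimately show ?thesis by (simp add: num_balanced_def Cs_def)
qed

text \<open>\<open>k I - A\<close> is a Gram matrix, hence positive semidefinite.\<close>

lemma eigenvalue_le_degree:
  assumes S: "signed_graph S" and reg: "regular_sgraph S k"
    and B: "eigenbasis (sg_verts S) (adj_entry S) I lam \<phi>" and i: "i \<in> I"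
  shows "lam i \<le> real k"
proof -
  obtain H where H: "incidence_matrix S H" using incidence_matrix_exists[OF S] by blast
  have "eigenbasis (sg_verts S) (\<lambda>u v. real k * of_bool (u = v) - adj_entry S u v) I
        (\<lambda>i. real k + (-1) * lam i) \<phi>"
    by (rule eigenbasis_affine[OF B]) simp
  from gram_norm[OF this incidence_is_gram[OF S H reg] i, symmetric]
  have "real k + (-1) * lam i \<ge> 0" by (simp add: sum_nonneg)
  then show ?thesis by simp
qed

lemma neg_sgraph_eigenbasis:
  assumes "eigenbasis (sg_verts S) (adj_entry S) I lam \<phi>"
  shows "eigenbasis (sg_verts (neg_sgraph S)) (adj_entry (neg_sgraph S)) I (\<lambda>i. - lam i) \<phi>"
proof -
  have "eigenbasis (sg_verts S) (adj_entry (neg_sgraph S)) I (\<lambda>i. 0 + (-1) * lam i) \<phi>"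
    by (rule eigenbasis_affine[OF assms]) (simp add: adj_entry_def neg_sgraph_def)
  then show ?thesis by (simp add: neg_sgraph_def)
qed

lemma signed_graph_neg: "signed_graph S \<Longrightarrow> signed_graph (neg_sgraph S)"
  by (auto simp: signed_graph_def neg_sgraph_def)

lemma regular_neg: "regular_sgraph S k \<Longrightarrow> regular_sgraph (neg_sgraph S) k"
  by (simp add: regular_sgraph_def neg_sgraph_def degree_in_def)

lemma card_eigenvalue_eq_neg_degree:
  assumes "signed_graph S" "regular_sgraph S k"
    and "eigenbasis (sg_verts S) (adj_entry S) I lam \<phi>"
  shows "card {i\<in>I. lam i = - real k} = num_balanced (neg_sgraph S)"
proof -
  have "{i\<in>I. lam i = - real k} = {i\<in>I. - lam i = real k}" by auto
  then show ?thesis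
    using card_eigenvalue_eq_degree[OF signed_graph_neg[OF assms(1)] regular_neg[OF assms(2)]
        neg_sgraph_eigenbasis[OF assms(3)]] by (simp only:)
qed

lemma eigenvalue_ge_neg_degree:
  assumes "signed_graph S" "regular_sgraph S k"
    and "eigenbasis (sg_verts S) (adj_entry S) I lam \<phi>" and "i \<in> I"
  shows "- real k \<le> lam i"
  using eigenvalue_le_degree[OF signed_graph_neg[OF assms(1)] regular_neg[OF assms(2)]
      neg_sgraph_eigenbasis[OF assms(3)] assms(4)]
  by simp

section \<open>Products and line graphs of regular signed graphs\<close>

lemma kronecker_sum_alt:
  assumes "finite N"
  shows "kronecker_sum N f x y = (\<Sum>i\<in>N. f i (x i) (y i) * of_bool (\<forall>j\<in>N - {i}. x j = y j))"
  unfolding kronecker_sum_def using assms by (intro sum.cong refl) (simp add: prod_if_eq prod_of_bool)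

lemma product_edge_iff:
  "{x, y} \<in> sg_edges (cartesian_product r G) \<longleftrightarrow>
     x \<in> sg_verts (cartesian_product r G) \<and> y \<in> sg_verts (cartesian_product r G)
     \<and> (\<exists>i\<in>{1..r}. {x i, y i} \<in> sg_edges (G i) \<and> (\<forall>j\<in>{1..r} - {i}. x j = y j))"
  (is "?l \<longleftrightarrow> ?R x y")
proof
  assume ?l
  then obtain f g where fg: "{x, y} = {f, g}" "?R f g"
    unfolding cartesian_product_def by (simp del: PiE_iff One_nat_def atLeastAtMost_iff) blast
  \<comment> \<open>\<open>{x, y} = {f, g}\<close> fixes the pair only up to order, so the symmetry
    of the relation is needed.\<close>
  moreover have "?R g f" using fg(2) by (metis insert_commute)
  ultimately show "?R x y" by (metis doubleton_eq_iff)
next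
  assume "?R x y"
  then show ?l unfolding cartesian_product_def by (simp del: PiE_iff One_nat_def atLeastAtMost_iff) blast
qed

text \<open>The ends of the edge differ in coordinate \<open>i\<close>, so every other summand has a
  vanishing indicator. \<open>f\<close> is left general to cover both signed entries and edge
  indicators.\<close>

lemma kronecker_sum_product_edge:
  fixes r :: nat
  assumes G: "\<And>i. i \<in> {1..r} \<Longrightarrow> signed_graph (G i)"
    and i: "i \<in> {1..r}" "{x i, y i} \<in> sg_edges (G i)" "\<forall>j\<in>{1..r} - {i}. x j = y j"
  shows "kronecker_sum {1..r} f x y = f i (x i) (y i)"
proof -
  have "card {x i, y i} = 2" using signed_graphD(4)[OF G[OF i(1)] i(2)] .
  then have ne: "x i \<noteq> y i" by auto
  have "kronecker_sum {1..r} f x y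
      = (\<Sum>l\<in>{1..r}. f l (x l) (y l) * of_bool (\<forall>j\<in>{1..r} - {l}. x j = y j))"
    by (rule kronecker_sum_alt[of "{1..r}" f x y]) simp
  also have "\<dots> = (\<Sum>l\<in>{i}. f l (x l) (y l) * of_bool (\<forall>j\<in>{1..r} - {l}. x j = y j))"
    using i(1) ne by (intro sum.mono_neutral_right) (auto simp: Bex_def)
  finally show ?thesis using i(3) by simp
qed

text \<open>In each summand either \<open>{x i, y i}\<close> is no edge of \<open>G i\<close>, or
  some other coordinate differs.\<close>

lemma kronecker_sum_product_no_edge:
  assumes "x \<in> sg_verts (cartesian_product r G)" "y \<in> sg_verts (cartesian_product r G)"
    and "{x, y} \<notin> sg_edges (cartesian_product r G)"
    and f: "\<And>i u v. i \<in> {1..r} \<Longrightarrow> {u, v} \<notin> sg_edges (G i) \<Longrightarrow> f i u v = 0"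
  shows "kronecker_sum {1..r} f x y = 0"
proof -
  have "f i (x i) (y i) * of_bool (\<forall>j\<in>{1..r} - {i}. x j = y j) = 0" if "i \<in> {1..r}" for i
  proof (cases "{x i, y i} \<in> sg_edges (G i)")
    case True
    then have "\<not> (\<forall>j\<in>{1..r} - {i}. x j = y j)" using assms(1-3) that product_edge_iff by metis
    then show ?thesis by (simp only: of_bool_eq(1) mult_zero_right)
  qed (use f[OF that] in simp)
  then have "(\<Sum>i\<in>{1..r}. f i (x i) (y i) * of_bool (\<forall>j\<in>{1..r} - {i}. x j = y j)) = 0"
    by (intro sum.neutral ballI)
  then show ?thesis by (simp only: kronecker_sum_alt[OF finite_atLeastAtMost])
qed

lemma adj_entry_product:
  assumes G: "\<And>i. i \<in> {1..r} \<Longrightarrow> signed_graph (G i)"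
    and xy: "x \<in> sg_verts (cartesian_product r G)" "y \<in> sg_verts (cartesian_product r G)"
  shows "adj_entry (cartesian_product r G) x y = kronecker_sum {1..r} (\<lambda>i. adj_entry (G i)) x y"
proof (cases "{x, y} \<in> sg_edges (cartesian_product r G)")
  case True
  then obtain i where i: "i \<in> {1..r}" "{x i, y i} \<in> sg_edges (G i)" "\<forall>j\<in>{1..r} - {i}. x j = y j"
    unfolding product_edge_iff by blast
  then show ?thesis using True cartesian_product_sign[where G = G, OF G i]
      kronecker_sum_product_edge[where G = G, OF G i]
    by (simp add: adj_entry_def)
next
  case False
  then show ?thesis
    using kronecker_sum_product_no_edge[OF xy False, of "\<lambda>i. adj_entry (G i)"]
    by (simp add: adj_entry_def)
qed

text \<open>The unsigned counterpart of the adjacency formula; its row sums are the degrees.\<close>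

lemma product_edge_kronecker_sum:
  assumes G: "\<And>i. i \<in> {1..r} \<Longrightarrow> signed_graph (G i)"
    and xy: "x \<in> sg_verts (cartesian_product r G)" "y \<in> sg_verts (cartesian_product r G)"
  shows "of_bool ({x, y} \<in> sg_edges (cartesian_product r G))
    = kronecker_sum {1..r} (\<lambda>i u v. of_bool ({u, v} \<in> sg_edges (G i))) x y"
proof (cases "{x, y} \<in> sg_edges (cartesian_product r G)")
  case True
  then obtain i where i: "i \<in> {1..r}" "{x i, y i} \<in> sg_edges (G i)" "\<forall>j\<in>{1..r} - {i}. x j = y j"
    unfolding product_edge_iff by blast
  then show ?thesis using True
      kronecker_sum_product_edge[where G = G, OF G i, of "\<lambda>i u v. of_bool ({u, v} \<in> sg_edges (G i))"]
    by simp
next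
  case False
  then show ?thesis
    using kronecker_sum_product_no_edge[OF xy False, of "\<lambda>i u v. of_bool ({u, v} \<in> sg_edges (G i))"]
    by simp
qed

text \<open>The map sending a neighbour \<open>v\<close> to \<open>{u, v}\<close> is a bijection
  onto the edges at \<open>u\<close>, which makes the degree a row sum.\<close>

lemma degree_conv_sum:
  assumes S: "signed_graph S"
  shows "real (degree_in S u) = (\<Sum>v\<in>sg_verts S. of_bool ({u, v} \<in> sg_edges S))"
proof -
  have "{e \<in> sg_edges S. u \<in> e} = (\<lambda>v. {u, v}) ` {v \<in> sg_verts S. {u, v} \<in> sg_edges S}"
  proof (intro equalityI subsetI)
    fix e assume "e \<in> {e \<in> sg_edges S. u \<in> e}"
    then have e: "e \<in> sg_edges S" "u \<in> e" by auto
    obtain a b where ab: "e = {a, b}" using signed_graphD(4)[OF S e(1)] by (meson card_2_iff)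
    define v where "v = (if a = u then b else a)"
    have "e = {u, v}" using ab e(2) by (auto simp: v_def)
    then show "e \<in> (\<lambda>v. {u, v}) ` {v \<in> sg_verts S. {u, v} \<in> sg_edges S}"
      using e(1) signed_graphD(3)[OF S e(1)] by blast
  qed auto
  moreover have "inj_on (\<lambda>v. {u, v}) A" for A by (auto simp: inj_on_def doubleton_eq_iff)
  ultimately have "degree_in S u = card {v \<in> sg_verts S. {u, v} \<in> sg_edges S}"
    by (simp add: degree_in_def card_image)
  then show ?thesis using signed_graphD(1)[OF S] by (simp add: sum_of_bool_eq Int_def)
qed

lemma regular_cartesian_product:
  assumes G: "\<And>i. i \<in> {1..r} \<Longrightarrow> signed_graph (G i)"
    and reg: "\<And>i. i \<in> {1..r} \<Longrightarrow> regular_sgraph (G i) (ks i)"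
  shows "regular_sgraph (cartesian_product r G) (\<Sum>i=1..r. ks i)"
  unfolding regular_sgraph_def
proof
  let ?S = "cartesian_product r G"
  fix x assume x: "x \<in> sg_verts ?S"
  have V: "sg_verts ?S = (\<Pi>\<^sub>E i\<in>{1..r}. sg_verts (G i))" by (simp add: cartesian_product_def)
  have fin: "finite (sg_verts (G i))" if "i \<in> {1..r}" for i using signed_graphD(1)[OF G[OF that]] .
  have S: "signed_graph ?S" using G by (rule signed_graph_cartesian_product)
  \<comment> \<open>The product of ones is the constant function 1 in the product form required by
    \<open>sum_kronecker_sum\<close>.\<close>
  have "real (degree_in ?S x)
      = (\<Sum>y\<in>sg_verts ?S. kronecker_sum {1..r} (\<lambda>i u v. of_bool ({u, v} \<in> sg_edges (G i))) x y
          * (\<Prod>l\<in>{1..r}. 1))"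
    unfolding degree_conv_sum[OF S]
    using product_edge_kronecker_sum[where G = G, OF G x] by (intro sum.cong refl) simp
  also have "\<dots> = (\<Sum>i\<in>{1..r}. \<Prod>l\<in>{1..r}. \<Sum>v\<in>sg_verts (G l).
      (if l = i then of_bool ({x l, v} \<in> sg_edges (G l)) else of_bool (x l = v)) * 1)"
    unfolding V
  proof (rule sum_kronecker_sum[where h = "\<lambda>_ _. 1" and x = x and N = "{1..r}"
        and V = "\<lambda>i. sg_verts (G i)" and f = "\<lambda>i u v. of_bool ({u, v} \<in> sg_edges (G i))"])
    show "finite (sg_verts (G i))" if "i \<in> {1..r}" for i using that by (rule fin)
  qed simp
  also have "\<dots> = (\<Sum>i\<in>{1..r}. \<Prod>l\<in>{1..r}. if l = i then real (ks l) else 1)"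
  proof (intro sum.cong prod.cong refl)
    fix i l assume l: "l \<in> {1..r}"
    have xl: "x l \<in> sg_verts (G l)" using PiE_mem[OF x[unfolded V] l] .
    then have "(\<Sum>v\<in>sg_verts (G l). of_bool ({x l, v} \<in> sg_edges (G l))) = real (ks l)"
      using degree_conv_sum[OF G[OF l], of "x l"] reg[OF l] by (simp add: regular_sgraph_def)
    moreover have "(\<Sum>v\<in>sg_verts (G l). of_bool (x l = v)) = (1 :: real)"
      using xl fin[OF l] by (simp add: of_bool_def)
    ultimately show "(\<Sum>v\<in>sg_verts (G l).
        (if l = i then of_bool ({x l, v} \<in> sg_edges (G l)) else of_bool (x l = v)) * 1)
      = (if l = i then real (ks l) else 1)"
      by (cases "l = i") simp_all
  qed
  also have "\<dots> = real (\<Sum>i=1..r. ks i)" by simp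
  finally show "degree_in ?S x = (\<Sum>i=1..r. ks i)" by (simp only: of_nat_eq_iff)
qed

text \<open>An edge meets \<open>k - 1\<close> others at each end. Subtraction of naturals is
  harmless, since an edge can only exist if \<open>k > 0\<close>.\<close>

lemma regular_line_graph:
  assumes S: "signed_graph S" and reg: "regular_sgraph S k"
  shows "regular_sgraph (line_graph S H) (2 * (k - 1))"
  unfolding regular_sgraph_def
proof
  fix e assume "e \<in> sg_verts (line_graph S H)"
  then have e: "e \<in> sg_edges S" by (simp add: line_graph_def)
  obtain u v where uv: "e = {u, v}" "u \<noteq> v" using signed_graphD(4)[OF S e] by (meson card_2_iff)
  have uvV: "u \<in> sg_verts S" "v \<in> sg_verts S" using signed_graphD(3)[OF S e] uv by auto
  define N where "N = (\<lambda>w. {f \<in> sg_edges S. w \<in> f} - {e})"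
  have fin: "finite (N w)" for w using signed_graphD(2)[OF S] by (simp add: N_def)
  have cardN: "card (N w) = k - 1" if "w \<in> sg_verts S" "w \<in> e" for w
    using reg that e unfolding N_def by (simp add: regular_sgraph_def degree_in_def card_Diff_singleton)
  \<comment> \<open>An edge in both sets would contain both ends of \<open>e\<close> and thus equal
    \<open>e\<close>.\<close>
  have "N u \<inter> N v = {}"
  proof (rule ccontr)
    assume "N u \<inter> N v \<noteq> {}"
    then obtain f where f: "f \<in> sg_edges S" "e \<subseteq> f" "f \<noteq> e" using uv by (auto simp: N_def)
    moreover have "card e = card f" "finite f"
      using signed_graphD(4)[OF S e] signed_graphD(4)[OF S f(1)] by (auto intro: card_ge_0_finite)
    ultimately show False using card_subset_eq by blast
  qed
  moreover have "{X \<in> sg_edges (line_graph S H). e \<in> X} = (\<lambda>f. {e, f}) ` (N u \<union> N v)"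
  proof (intro equalityI subsetI)
    fix X assume "X \<in> {X \<in> sg_edges (line_graph S H). e \<in> X}"
    then obtain a b where ab: "X = {a, b}" "a \<in> sg_edges S" "b \<in> sg_edges S" "a \<noteq> b" "a \<inter> b \<noteq> {}"
      and "e \<in> X" unfolding line_graph_def by auto
    then have "e = a \<or> e = b" by blast
    then obtain f where f: "X = {e, f}" "f \<in> sg_edges S" "f \<noteq> e" "e \<inter> f \<noteq> {}"
      using ab by (metis Int_commute insert_commute)
    from f(4) uv(1) have "u \<in> f \<or> v \<in> f" by blast
    then have "f \<in> N u \<union> N v" using f(2,3) unfolding N_def by blast
    then show "X \<in> (\<lambda>f. {e, f}) ` (N u \<union> N v)" using f(1) by blast
  next
    fix X assume "X \<in> (\<lambda>f. {e, f}) ` (N u \<union> N v)"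
    then obtain f where f: "X = {e, f}" "f \<in> N u \<union> N v" by blast
    then have "f \<in> sg_edges S" "e \<noteq> f" "e \<inter> f \<noteq> {}" using uv by (auto simp: N_def)
    then show "X \<in> {X \<in> sg_edges (line_graph S H). e \<in> X}"
      using e f(1) unfolding line_graph_def by auto
  qed
  moreover have "inj_on (\<lambda>f. {e, f}) A" for A by (auto simp: inj_on_def doubleton_eq_iff)
  ultimately show "degree_in (line_graph S H) e = 2 * (k - 1)"
    using fin cardN uv uvV by (simp add: degree_in_def card_image card_Un_disjoint)
qed

section \<open>The Laplacian of a regular signed graph\<close>

lemma regular_laplacian_eigenvalues:
  assumes S: "signed_graph S" and reg: "regular_sgraph S d"
  shows "sg_laplacian_eigenvalues S = image_mset (\<lambda>x. real d - x) (sg_eigenvalues S)"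
proof -
  obtain lam \<phi> where B: "eigenbasis (sg_verts S) (adj_entry S) {..<card (sg_verts S)} lam \<phi>"
    using eigenbasis_exists[OF signed_graphD(1)[OF S], of "adj_entry S"] adj_entry_commute[of S] by blast
  define g where "g = (\<lambda>u v. (if u = v then real (degree_in S u) else 0) - adj_entry S u v)"
  have "laplacian_matrix S = vertex_matrix S g"
    by (rule eq_matI) (simp_all add: laplacian_matrix_def degree_matrix_def adjacency_matrix_def vertex_matrix_def g_def)
  moreover have "eigenbasis (sg_verts S) g {..<card (sg_verts S)} (\<lambda>i. real d + (-1) * lam i) \<phi>"
    by (rule eigenbasis_affine[OF B]) (use reg in \<open>auto simp: g_def regular_sgraph_def\<close>)
  ultimately show ?thesis
    using eigenbasis_mat_eigenvalues[OF B]
    by (simp add: sg_laplacian_eigenvalues_def sg_eigenvalues_def adjacency_matrix_def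
        eigenbasis_mat_eigenvalues multiset.map_comp o_def)
qed

text \<open>By the handshake identity the average degree is \<open>d\<close>, so the Laplacian
  eigenvalue \<open>d - x\<close> deviates from it by the absolute value of
  \<open>x\<close>.\<close>

lemma regular_laplacian_energy:
  assumes S: "signed_graph S" and reg: "regular_sgraph S d"
  shows "laplacian_energy S = energy S"
proof (cases "card (sg_verts S) = 0")
  \<comment> \<open>Here \<open>average_degree\<close> is 0 through division by zero, but both
    spectra are empty.\<close>
  case True
  then have "sg_eigenvalues S = {#}" "sg_laplacian_eigenvalues S = {#}"
    using size_sg_eigenvalues[of S] size_sg_laplacian_eigenvalues[of S] by simp_all
  then show ?thesis by (simp add: laplacian_energy_def energy_def)
next
  case False
  have "average_degree S = real (2 * card (sg_edges S)) / real (card (sg_verts S))"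
    by (simp add: average_degree_def)
  also have "\<dots> = real d" unfolding handshake[OF S reg] using False by simp
  finally show ?thesis
    by (simp add: laplacian_energy_def energy_def regular_laplacian_eigenvalues[OF S reg] multiset.map_comp o_def)
qed

section \<open>Multiplicities in the spectrum of the line graph\<close>

lemma count_image_mset_mset_set:
  "finite I \<Longrightarrow> count (image_mset f (mset_set I)) x = card {i\<in>I. f i = x}"
  by (simp add: count_image_mset' eq_commute)

text \<open>For the two Gram matrices the common value is their rank; its complement gives access to
  the multiplicity of 0.\<close>

lemma card_nonzero_eq:
  fixes mu :: "'i \<Rightarrow> real" and nu :: "'j \<Rightarrow> real"
  assumes fin: "finite I" "finite K"
    and eq: "\<And>x. x \<noteq> 0 \<Longrightarrow> card {i\<in>I. mu i = x} = card {k\<in>K. nu k = x}"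
  shows "card {i\<in>I. mu i \<noteq> 0} = card {k\<in>K. nu k \<noteq> 0}"
proof -
  have "filter_mset (\<lambda>x. x \<noteq> 0) (image_mset mu (mset_set I))
      = filter_mset (\<lambda>x. x \<noteq> 0) (image_mset nu (mset_set K))"
    using fin eq by (intro multiset_eqI) (simp add: count_image_mset_mset_set)
  from arg_cong[OF this, of size] show ?thesis
    using fin by (simp add: filter_mset_image_mset)
qed

text \<open>A common nonzero eigenvalue \<open>y = k - lam j = 2 - nu i\<close> of the Gram matrices
  means \<open>nu i = 2 - k + lam j\<close>. The case \<open>y = 0\<close> is \<open>x = 2\<close>,
  settled by comparing the sizes of the two index sets.\<close>

lemma line_graph_eigenvalue_count:
  assumes S: "signed_graph S" and reg: "regular_sgraph S k" and H: "incidence_matrix S H"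
    and \<phi>: "eigenbasis (sg_verts S) (adj_entry S) J lam \<phi>"
  shows "real (count (sg_eigenvalues (line_graph S H)) x)
    = real (card {j\<in>J. 2 - real k + lam j = x})
      + (if x = 2 then real (card (sg_verts S)) * (real k - 2) / 2 else 0)"
proof -
  let ?L = "line_graph S H"
  have VL: "sg_verts ?L = sg_edges S" by (simp add: line_graph_def)
  define K where "K = {..<card (sg_edges S)}"
  obtain nu \<psi> where \<psi>: "eigenbasis (sg_edges S) (adj_entry ?L) K nu \<psi>"
    using eigenbasis_exists[OF signed_graphD(2)[OF S], of "adj_entry ?L"] adj_entry_commute[of ?L]
    unfolding K_def by blast
  have eig: "sg_eigenvalues ?L = image_mset nu (mset_set K)"
    using eigenbasis_mat_eigenvalues[of ?L, unfolded VL, OF \<psi>]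
    by (simp add: sg_eigenvalues_def adjacency_matrix_def)
  have finJ: "finite J" and finK: "finite K" using eigenbasisD(2)[OF \<phi>] by (auto simp: K_def)
  have \<phi>': "eigenbasis (sg_verts S) (\<lambda>u v. real k * of_bool (u = v) - adj_entry S u v) J
      (\<lambda>j. real k + (-1) * lam j) \<phi>"
    by (rule eigenbasis_affine[OF \<phi>]) simp
  have \<psi>': "eigenbasis (sg_edges S) (\<lambda>e f. 2 * of_bool (e = f) - adj_entry ?L e f) K
      (\<lambda>i. 2 + (-1) * nu i) \<psi>"
    by (rule eigenbasis_affine[OF \<psi>]) simp
  have gram: "is_gram (sg_edges S) (\<lambda>e f. 2 * of_bool (e = f) - adj_entry ?L e f) (sg_verts S)
      (\<lambda>e v. H v e)"
    unfolding is_gram_def using adj_entry_line_graph[OF S H] by simp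
  have count: "card {j\<in>J. real k + (-1) * lam j = y} = card {i\<in>K. 2 + (-1) * nu i = y}"
    if "y \<noteq> 0" for y
    by (rule gram_eigenvalue_count[OF \<phi>' incidence_is_gram[OF S H reg] \<psi>' gram that])
  show ?thesis
  proof (cases "x = 2")
    case False
    have "{j\<in>J. real k + (-1) * lam j = 2 - x} = {j\<in>J. 2 - real k + lam j = x}"
      "{i\<in>K. 2 + (-1) * nu i = 2 - x} = {i\<in>K. nu i = x}" by auto
    then show ?thesis using count[of "2 - x"] False finK
      by (simp add: eig count_image_mset_mset_set)
  next
    case True
    have "card {j\<in>J. real k + (-1) * lam j \<noteq> 0} = card {i\<in>K. 2 + (-1) * nu i \<noteq> 0}"
      using finJ finK count by (rule card_nonzero_eq)
    moreover have "{j\<in>J. real k + (-1) * lam j \<noteq> 0} = J - {j\<in>J. 2 - real k + lam j = x}"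
      "{i\<in>K. 2 + (-1) * nu i \<noteq> 0} = K - {i\<in>K. nu i = x}" using True by auto
    \<comment> \<open>These are differences of naturals; the two inequalities that follow make them
      exact.\<close>
    ultimately have "card J - card {j\<in>J. 2 - real k + lam j = x} = card K - card {i\<in>K. nu i = x}"
      using finJ finK by (simp add: card_Diff_subset)
    moreover have "card {j\<in>J. 2 - real k + lam j = x} \<le> card J" "card {i\<in>K. nu i = x} \<le> card K"
      using finJ finK by (auto intro!: card_mono)
    moreover have "real (2 * card K) = real (card J * k)"
      using handshake[OF S reg] eigenbasis_card[OF \<phi>] by (simp add: K_def)
    ultimately show ?thesis using True finK eigenbasis_card[OF \<phi>]
      by (simp add: eig count_image_mset_mset_set field_simps)
  qed
qed

text \<open>The natural number \<open>2 * (k - 1)\<close> and the real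
  \<open>2 * (real k - 1)\<close> differ only for \<open>k = 0\<close>; then there are no edges and
  both multisets are empty.\<close>

lemma line_graph_laplacian_eigenvalues:
  assumes S: "signed_graph S" and reg: "regular_sgraph S k" and H: "incidence_matrix S H"
  shows "sg_laplacian_eigenvalues (line_graph S H)
    = image_mset (\<lambda>x. 2 * (real k - 1) - x) (sg_eigenvalues (line_graph S H))"
proof (cases "k = 0")
  case True
  then have "card (sg_verts (line_graph S H)) = 0"
    using handshake[OF S reg] by (simp add: line_graph_def)
  then have "sg_eigenvalues (line_graph S H) = {#}" "sg_laplacian_eigenvalues (line_graph S H) = {#}"
    using size_sg_eigenvalues[of "line_graph S H"] size_sg_laplacian_eigenvalues[of "line_graph S H"]
    by simp_all
  then show ?thesis by simp
next
  case False
  then show ?thesis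
    using regular_laplacian_eigenvalues[OF signed_graph_line_graph[OF S H] regular_line_graph[OF S reg]]
    by (simp add: of_nat_diff)
qed

text \<open>\<open>c\<close> may be negative, so \<open>M\<close> is known only through its counts.
  The sum is taken over the finite set \<open>X\<close> of all values involved, weighted by these
  counts.\<close>

lemma sum_mset_conv_count:
  fixes g :: "'b \<Rightarrow> real"
  assumes J: "finite J"
    and count: "\<And>x. real (count M x) = real (card {j\<in>J. h j = x}) + (if x = a then c else 0)"
  shows "(\<Sum>x\<in>#M. g x) = (\<Sum>j\<in>J. g (h j)) + c * g a"
proof -
  define X where "X = set_mset M \<union> h ` J \<union> {a}"
  have X: "finite X" using J by (simp add: X_def)
  have "set_mset M \<subseteq> X" by (auto simp: X_def)
  then have "(\<Sum>x\<in>#M. g x) = (\<Sum>x\<in>X. real (count M x) * g x)"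
  proof (induction M)
    case (add y M)
    have "(\<Sum>x\<in>X. real (count (add_mset y M) x) * g x)
        = (\<Sum>x\<in>X. (if x = y then g x else 0) + real (count M x) * g x)"
      by (intro sum.cong refl) (auto simp: algebra_simps)
    then show ?case using add X by (simp add: sum.distrib)
  qed simp
  also have "\<dots> = (\<Sum>x\<in>X. real (card {j\<in>J. h j = x}) * g x + (if x = a then c * g a else 0))"
    unfolding count by (intro sum.cong refl) (auto simp: algebra_simps)
  also have "\<dots> = (\<Sum>x\<in>X. \<Sum>j\<in>{j\<in>J. h j = x}. g (h j)) + c * g a"
    using X by (simp add: sum.distrib X_def)
  also have "(\<Sum>x\<in>X. \<Sum>j\<in>{j\<in>J. h j = x}. g (h j)) = (\<Sum>j\<in>J. g (h j))"
    using J X by (intro sum.group) (auto simp: X_def)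
  finally show ?thesis .
qed

text \<open>The tuples attaining the bound form a \<open>PiE\<close> again, so their number is a
  product.\<close>

lemma card_PiE_sum_eq_bound:
  fixes lam :: "'n \<Rightarrow> 'i \<Rightarrow> real"
  assumes N: "finite N" and le: "\<And>i m. i \<in> N \<Longrightarrow> m \<in> I i \<Longrightarrow> lam i m \<le> b i"
  shows "card {j \<in> PiE N I. (\<Sum>i\<in>N. lam i (j i)) = sum b N}
    = (\<Prod>i\<in>N. card {m \<in> I i. lam i m = b i})"
proof -
  have "{j \<in> PiE N I. (\<Sum>i\<in>N. lam i (j i)) = sum b N} = PiE N (\<lambda>i. {m \<in> I i. lam i m = b i})"
  proof (intro equalityI subsetI)
    fix j assume "j \<in> {j \<in> PiE N I. (\<Sum>i\<in>N. lam i (j i)) = sum b N}"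
    then have j: "j \<in> PiE N I" "(\<Sum>i\<in>N. lam i (j i)) = sum b N" by auto
    have "lam i (j i) = b i" if "i \<in> N" for i
      using j N le by (intro sum_mono_inv[OF j(2) _ that N]) (auto dest: PiE_mem)
    then show "j \<in> PiE N (\<lambda>i. {m \<in> I i. lam i m = b i})" using j(1) by (auto simp: PiE_iff)
  next
    fix j assume "j \<in> PiE N (\<lambda>i. {m \<in> I i. lam i m = b i})"
    then show "j \<in> {j \<in> PiE N I. (\<Sum>i\<in>N. lam i (j i)) = sum b N}"
      by (auto simp: PiE_iff intro: sum.cong)
  qed
  then show ?thesis using N by (simp add: card_PiE)
qed

text \<open>The additional eigenvalues enter \<open>count\<close> as a real summand, which for
  \<open>k < 2\<close> becomes a deduction from the multiplicity of 2. For \<open>k = 0\<close> the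
  natural number \<open>2 * (k - 1)\<close> is 0, and \<open>L\<close> has no vertices.\<close>

theorem theorem3p12:
  fixes r :: nat and G :: "nat \<Rightarrow> 'v sgraph" and ns ks :: "nat \<Rightarrow> nat"
    and lam :: "nat \<Rightarrow> nat \<Rightarrow> real" and H :: "(nat \<Rightarrow> 'v) \<Rightarrow> (nat \<Rightarrow> 'v) set \<Rightarrow> real"
  assumes r: "r \<ge> 1"
    and graphs: "\<And>i. i \<in> {1..r} \<Longrightarrow> signed_graph (G i)"
    and order: "\<And>i. i \<in> {1..r} \<Longrightarrow> card (sg_verts (G i)) = ns i"
    and regular: "\<And>i. i \<in> {1..r} \<Longrightarrow> regular_sgraph (G i) (ks i)"
    and eigenvalues: "\<And>i. i \<in> {1..r} \<Longrightarrow>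
          image_mset (lam i) (mset_set {1..ns i}) = sg_eigenvalues (G i)"
    and incidence: "incidence_matrix (cartesian_product r G) H"
  defines "k \<equiv> (\<Sum>i=1..r. ks i)"
    and "n \<equiv> (\<Prod>i=1..r. ns i)"
    and "S \<equiv> cartesian_product r G"
    and "L \<equiv> line_graph (cartesian_product r G) H"
    and "J \<equiv> (\<Pi>\<^sub>E i\<in>{1..r}. {1..ns i})"
    and "ev \<equiv> (\<lambda>j. 2 - real (\<Sum>i=1..r. ks i) + (\<Sum>i=1..r. lam i (j i)))"
    and "evL \<equiv> (\<lambda>j. 3 * real (\<Sum>i=1..r. ks i) - 4 - (\<Sum>i=1..r. lam i (j i)))"
  shows "regular_sgraph S k
    \<and> regular_sgraph L (2 * (k - 1))
    \<and> (\<forall>x. real (count (sg_eigenvalues L) x) =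
           real (card {j \<in> J. ev j = x}) + (if x = 2 then real n * (real k - 2) / 2 else 0))
    \<and> card {j \<in> J. ev j = 2} = num_balanced S
    \<and> num_balanced S = (\<Prod>i=1..r. num_balanced (G i))
    \<and> (\<forall>j\<in>J. ev j \<noteq> 2 \<longrightarrow> ev j < 2 \<and> ev j \<ge> - 2 * (real k - 1))
    \<and> card {j \<in> J. ev j = - 2 * (real k - 1)} = num_balanced (neg_sgraph S)
    \<and> num_balanced (neg_sgraph S) = (\<Prod>i=1..r. num_balanced (neg_sgraph (G i)))
    \<and> energy L = (\<Sum>j\<in>J. \<bar>(\<Sum>i=1..r. lam i (j i)) + 2 - real k\<bar>) + (real k - 2) * real n
    \<and> laplacian_energy L = energy L
    \<and> (\<forall>x. real (count (sg_laplacian_eigenvalues L) x) =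
           real (card {j \<in> J. evL j = x}) +
             (if x = 2 * real k - 4 then real n * (real k - 2) / 2 else 0))
    \<and> card {j \<in> J. evL j = 2 * real k - 4} = (\<Prod>i=1..r. num_balanced (G i))
    \<and> (\<forall>j\<in>J. evL j \<noteq> 2 * real k - 4 \<longrightarrow> evL j > 2 * real k - 4 \<and> evL j \<le> 4 * real k - 4)
    \<and> card {j \<in> J. evL j = 4 * real k - 4} = num_balanced (neg_sgraph S)"
proof -
  let ?N = "{1..r}"
  have "\<exists>\<phi>. eigenbasis (sg_verts (G i)) (adj_entry (G i)) {1..ns i} (lam i) \<phi>" if i: "i \<in> ?N" for i
    using eigenbasis_of_eigenvalues[OF signed_graphD(1)[OF graphs[OF i]] finite_atLeastAtMost,
        of "adj_entry (G i)" "lam i" 1 "ns i"] adj_entry_commute[of "G i"] eigenvalues[OF i]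
    unfolding sg_eigenvalues_def adjacency_matrix_def by blast
  then obtain \<phi> where \<phi>: "\<And>i. i \<in> ?N \<Longrightarrow>
      eigenbasis (sg_verts (G i)) (adj_entry (G i)) {1..ns i} (lam i) (\<phi> i)"
    by (metis (no_types, lifting) bchoice)
  define Lam where "Lam = (\<lambda>j. \<Sum>i=1..r. lam i (j i))"
  define \<Phi> where "\<Phi> = (\<lambda>j x. \<Prod>i\<in>?N. \<phi> i (j i) (x i))"
  have S: "signed_graph S" unfolding S_def using graphs by (rule signed_graph_cartesian_product)
  have reg: "regular_sgraph S k" unfolding S_def k_def
    using graphs regular by (rule regular_cartesian_product)
  have H: "incidence_matrix S H" using incidence by (simp add: S_def)
  have V: "sg_verts S = (\<Pi>\<^sub>E i\<in>?N. sg_verts (G i))" by (simp add: S_def cartesian_product_def)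
  have "eigenbasis (sg_verts S) (kronecker_sum ?N (\<lambda>i. adj_entry (G i))) J Lam \<Phi>"
    unfolding V J_def Lam_def \<Phi>_def using \<phi> by (rule eigenbasis_kronecker_sum[OF finite_atLeastAtMost])
  \<comment> \<open>The coefficients 0 and 1 merely exchange the Kronecker sum for
    \<open>adj_entry S\<close>, with which it agrees on the vertices.\<close>
  from eigenbasis_affine[OF this, where a = 0 and b = 1 and g = "adj_entry S"]
  have \<Phi>: "eigenbasis (sg_verts S) (adj_entry S) J Lam \<Phi>"
    using adj_entry_product[where G = G, OF graphs] by (simp add: S_def)
  have finJ: "finite J" using eigenbasisD(2)[OF \<Phi>] .
  have cardV: "card (sg_verts S) = n" by (simp add: V n_def card_PiE order)
  have ev: "ev j = 2 - real k + Lam j" and evL: "evL j = 3 * real k - 4 - Lam j" for j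
    by (simp_all add: ev_def evL_def k_def Lam_def)
  have count: "real (count (sg_eigenvalues L) x) =
      real (card {j \<in> J. ev j = x}) + (if x = 2 then real n * (real k - 2) / 2 else 0)" for x
    using line_graph_eigenvalue_count[OF S reg H \<Phi>, of x]
    by (simp only: ev cardV L_def S_def[symmetric])
  have bounds: "Lam j \<le> real k" "- real k \<le> Lam j" if "j \<in> J" for j
    using eigenvalue_le_degree[OF S reg \<Phi> that] eigenvalue_ge_neg_degree[OF S reg \<Phi> that] .
  have bal: "card {j \<in> J. Lam j = real k} = num_balanced S"
    by (rule card_eigenvalue_eq_degree[OF S reg \<Phi>])
  have neg: "card {j \<in> J. Lam j = - real k} = num_balanced (neg_sgraph S)"
    by (rule card_eigenvalue_eq_neg_degree[OF S reg \<Phi>])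
  have "card {j \<in> J. Lam j = real k} = (\<Prod>i=1..r. card {m \<in> {1..ns i}. lam i m = real (ks i)})"
    unfolding Lam_def J_def k_def of_nat_sum
    using eigenvalue_le_degree[OF graphs regular \<phi>] by (intro card_PiE_sum_eq_bound) auto
  also have "\<dots> = (\<Prod>i=1..r. num_balanced (G i))"
    using card_eigenvalue_eq_degree[OF graphs regular \<phi>] by (intro prod.cong refl) blast
  finally have prod_bal: "num_balanced S = (\<Prod>i=1..r. num_balanced (G i))" by (simp add: bal)
  \<comment> \<open>Negating the eigenvalues turns the lower bound into an upper one. The negated
    factors are counted directly, without presenting \<open>neg_sgraph S\<close> as a
    product.\<close>
  have "card {j \<in> J. Lam j = - real k} = card {j \<in> J. (\<Sum>i=1..r. - lam i (j i)) = real k}"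
    by (rule arg_cong[of _ _ card]) (auto simp: Lam_def sum_negf)
  also have "\<dots> = (\<Prod>i=1..r. card {m \<in> {1..ns i}. - lam i m = real (ks i)})"
    unfolding J_def k_def of_nat_sum
  proof (rule card_PiE_sum_eq_bound)
    fix i m assume i: "i \<in> ?N" and m: "m \<in> {1..ns i}"
    show "- lam i m \<le> real (ks i)"
      using eigenvalue_ge_neg_degree[OF graphs[OF i] regular[OF i] \<phi>[OF i] m] by linarith
  qed simp
  also have "\<dots> = (\<Prod>i=1..r. num_balanced (neg_sgraph (G i)))"
  proof (rule prod.cong[OF refl])
    fix i assume i: "i \<in> ?N"
    have "{m \<in> {1..ns i}. - lam i m = real (ks i)} = {m \<in> {1..ns i}. lam i m = - real (ks i)}" by auto
    then show "card {m \<in> {1..ns i}. - lam i m = real (ks i)} = num_balanced (neg_sgraph (G i))"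
      using card_eigenvalue_eq_neg_degree[OF graphs[OF i] regular[OF i] \<phi>[OF i]] by (simp only:)
  qed
  finally have prod_neg: "num_balanced (neg_sgraph S) = (\<Prod>i=1..r. num_balanced (neg_sgraph (G i)))"
    by (simp add: neg)
  have "energy L = (\<Sum>j\<in>J. \<bar>ev j\<bar>) + real n * (real k - 2) / 2 * \<bar>2\<bar>"
    unfolding energy_def using finJ count by (rule sum_mset_conv_count)
  also have "(\<Sum>j\<in>J. \<bar>ev j\<bar>) = (\<Sum>j\<in>J. \<bar>(\<Sum>i=1..r. lam i (j i)) + 2 - real k\<bar>)"
    by (simp add: ev Lam_def algebra_simps)
  finally have energy: "energy L
      = (\<Sum>j\<in>J. \<bar>(\<Sum>i=1..r. lam i (j i)) + 2 - real k\<bar>) + (real k - 2) * real n" by simp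
  have regL: "regular_sgraph L (2 * (k - 1))"
    unfolding L_def S_def[symmetric] by (rule regular_line_graph[OF S reg])
  have lap_energy: "laplacian_energy L = energy L"
    using signed_graph_line_graph[OF S H] regL unfolding L_def S_def[symmetric]
    by (rule regular_laplacian_energy)
  have countL: "real (count (sg_laplacian_eigenvalues L) x) = real (card {j \<in> J. evL j = x}) +
      (if x = 2 * real k - 4 then real n * (real k - 2) / 2 else 0)" for x
  proof -
    \<comment> \<open>The reflection is its own inverse, so counts are transported to the reflected
      value; it exchanges 2 and \<open>2 * real k - 4\<close>.\<close>
    have "count (image_mset (\<lambda>y. 2 * (real k - 1) - y) M) x = count M (2 * (real k - 1) - x)" for M
      by (induction M) auto
    then have "count (sg_laplacian_eigenvalues L) x = count (sg_eigenvalues L) (2 * (real k - 1) - x)"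
      using line_graph_laplacian_eigenvalues[OF S reg H] unfolding L_def S_def by metis
    moreover have "{j \<in> J. ev j = 2 * (real k - 1) - x} = {j \<in> J. evL j = x}" by (auto simp: ev evL)
    moreover have "2 * (real k - 1) - x = 2 \<longleftrightarrow> x = 2 * real k - 4" by auto
    ultimately show ?thesis using count[of "2 * (real k - 1) - x"] by (simp only:)
  qed
  \<comment> \<open>The extreme values \<open>2k - 4\<close> and \<open>4k - 4\<close> are
    \<open>3k - 4 - k\<close> and \<open>3k - 4 + k\<close>, attained where \<open>Lam j\<close> is
    \<open>k\<close> and \<open>-k\<close>.\<close>
  have sets: "{j \<in> J. ev j = 2} = {j \<in> J. Lam j = real k}"
    "{j \<in> J. ev j = - 2 * (real k - 1)} = {j \<in> J. Lam j = - real k}"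
    "{j \<in> J. evL j = 2 * real k - 4} = {j \<in> J. Lam j = real k}"
    "{j \<in> J. evL j = 4 * real k - 4} = {j \<in> J. Lam j = - real k}"
    by (auto simp: ev evL)
  have ev_bounds: "\<forall>j\<in>J. ev j \<noteq> 2 \<longrightarrow> ev j < 2 \<and> ev j \<ge> - 2 * (real k - 1)"
    "\<forall>j\<in>J. evL j \<noteq> 2 * real k - 4 \<longrightarrow> evL j > 2 * real k - 4 \<and> evL j \<le> 4 * real k - 4"
    using bounds by (fastforce simp: ev evL)+
  show ?thesis
    by (intro conjI allI)
      (fact reg regL count ev_bounds prod_bal prod_neg energy lap_energy countL
        | simp only: sets bal neg prod_bal[symmetric])+
qed

end
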